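(* Let $d\ge3$ be an integer. There is a constant $C=C(d)$ such that for every prime $p$, all polynomials $\phi_1,\phi_2\in\mathbb{F}_p[y]$ that vanish at $0$, are linearly independent over $\mathbb{F}_p$ and satisfy $\deg\phi_1=\deg\phi_2=d$, every $\lambda\in\mathbb{F}_p^\times$ and all $m,m'\in\mathbb{F}_p$, $$|S_\lambda(m,m')|\le C\,p^2.$$
   Context: Write $\phi_1(y)=ay^d+\cdots$, $\phi_2(y)=by^d+\cdots$ with $a,b\in\mathbb{F}_p^\times$; put $\alpha=b/a$ and $D=\phi_2-\alpha\phi_1$. Let $\psi(t)=e^{2\pi i t/p}$ for $t\in\mathbb{F}_p$. Define $$W=\{(y_1,y_2,y_3,y_4)\in\mathbb{A}^4:\ \phi_1(y_1)-\phi_1(y_2)=\phi_1(y_3)-\phi_1(y_4)\},$$ and, on $W$, $$f_0=\lambda\,(D(y_4)-D(y_2)),\qquad f_1=\phi_2(y_1)-\phi_2(y_2),\qquad f_2=\phi_2(y_4)-\phi_2(y_3).$$ For $m,m'\in\mathbb{F}_p$, $$S_\lambda(m,m')=\sum_{w\in W(\mathbb{F}_p)}\psi\big(f_0(w)+m f_1(w)+m' f_2(w)\big).$$ *)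

theory Defs
  imports Complex_Main "HOL-Algebra.Polynomial_Divisibility"
    "HOL-Number_Theory.Residues"
begin

abbreviation prime_field :: "nat \<Rightarrow> int ring"  (\<open>\<bbbF>\<close>)
  where "\<bbbF> p \<equiv> residue_ring (int p)"

text \<open>
  Polynomials are those of \<^theory>\<open>HOL-Algebra.Polynomials\<close>: coefficient lists with the
  leading coefficient first. The scalars inside \<^term>\<open>poly_ring R\<close> are the constant
  polynomials.
\<close>

definition lin_indep :: "('a, 'b) ring_scheme \<Rightarrow> 'a list \<Rightarrow> 'a list \<Rightarrow> bool"
  where "lin_indep R \<phi>1 \<phi>2 \<longleftrightarrow>
    ring.independent (poly_ring R) (ring.poly_of_const R ` carrier R) [\<phi>1, \<phi>2]"

definition lc_ratio :: "('a, 'b) ring_scheme \<Rightarrow> 'a list \<Rightarrow> 'a list \<Rightarrow> 'a"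
  where "lc_ratio R \<phi>1 \<phi>2 =
    Polynomials.lead_coeff \<phi>2 \<otimes>\<^bsub>R\<^esub> inv\<^bsub>R\<^esub> (Polynomials.lead_coeff \<phi>1)"

definition D_poly :: "('a, 'b) ring_scheme \<Rightarrow> 'a list \<Rightarrow> 'a list \<Rightarrow> 'a list"
  where "D_poly R \<phi>1 \<phi>2 =
    \<phi>2 \<ominus>\<^bsub>poly_ring R\<^esub>
      (ring.poly_of_const R (lc_ratio R \<phi>1 \<phi>2) \<otimes>\<^bsub>poly_ring R\<^esub> \<phi>1)"

definition W_points :: "('a, 'b) ring_scheme \<Rightarrow> 'a list \<Rightarrow> ('a \<times> 'a \<times> 'a \<times> 'a) set"
  where "W_points R \<phi>1 =
    {(y1, y2, y3, y4).
       y1 \<in> carrier R \<and> y2 \<in> carrier R \<and> y3 \<in> carrier R \<and> y4 \<in> carrier R \<and>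
       ring.eval R \<phi>1 y1 \<ominus>\<^bsub>R\<^esub> ring.eval R \<phi>1 y2 =
       ring.eval R \<phi>1 y3 \<ominus>\<^bsub>R\<^esub> ring.eval R \<phi>1 y4}"

definition f0 :: "('a, 'b) ring_scheme \<Rightarrow> 'a list \<Rightarrow> 'a list \<Rightarrow> 'a \<Rightarrow> 'a \<times> 'a \<times> 'a \<times> 'a \<Rightarrow> 'a"
  where "f0 R \<phi>1 \<phi>2 l = (\<lambda>(y1, y2, y3, y4).
    l \<otimes>\<^bsub>R\<^esub>
      (ring.eval R (D_poly R \<phi>1 \<phi>2) y4 \<ominus>\<^bsub>R\<^esub> ring.eval R (D_poly R \<phi>1 \<phi>2) y2))"

definition f1 :: "('a, 'b) ring_scheme \<Rightarrow> 'a list \<Rightarrow> 'a \<times> 'a \<times> 'a \<times> 'a \<Rightarrow> 'a"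
  where "f1 R \<phi>2 = (\<lambda>(y1, y2, y3, y4). ring.eval R \<phi>2 y1 \<ominus>\<^bsub>R\<^esub> ring.eval R \<phi>2 y2)"

definition f2 :: "('a, 'b) ring_scheme \<Rightarrow> 'a list \<Rightarrow> 'a \<times> 'a \<times> 'a \<times> 'a \<Rightarrow> 'a"
  where "f2 R \<phi>2 = (\<lambda>(y1, y2, y3, y4). ring.eval R \<phi>2 y4 \<ominus>\<^bsub>R\<^esub> ring.eval R \<phi>2 y3)"

definition \<psi> :: "nat \<Rightarrow> int \<Rightarrow> complex"
  where "\<psi> p t = exp (2 * of_real pi * \<i> * of_int t / of_nat p)"

definition S_sum ::
    "nat \<Rightarrow> int list \<Rightarrow> int list \<Rightarrow> int \<Rightarrow> int \<Rightarrow> int \<Rightarrow> complex"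
  where "S_sum p \<phi>1 \<phi>2 l m m' =
    (\<Sum>w\<in>W_points (\<bbbF> p) \<phi>1.
       \<psi> p (f0 (\<bbbF> p) \<phi>1 \<phi>2 l w
             \<oplus>\<^bsub>\<bbbF> p\<^esub> m \<otimes>\<^bsub>\<bbbF> p\<^esub> f1 (\<bbbF> p) \<phi>2 w
             \<oplus>\<^bsub>\<bbbF> p\<^esub> m' \<otimes>\<^bsub>\<bbbF> p\<^esub> f2 (\<bbbF> p) \<phi>2 w))"

end

theory Submission
  imports Defs "HOL-Algebra.Algebraic_Closure_Type" "Berlekamp_Zassenhaus.Finite_Field"
    "HOL-Computational_Algebra.Formal_Power_Series"
    "HOL-Computational_Algebra.Fundamental_Theorem_Algebra"
begin

text \<open>
  Detecting the equation of \<open>W\<close> by additive characters modulo \<open>p\<close> turns \<open>p S\<close> into the sum over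
  \<open>s\<close> of a product of four one-variable sums \<open>T u v = \<Sum>y. \<psi> (u \<phi>1(y) + v \<phi>2(y))\<close>, at the pairs
  \<open>(s, m)\<close>, \<open>(l \<alpha> - s, - l - m)\<close>, \<open>(- s, - m')\<close> and \<open>(s - l \<alpha>, l + m')\<close>, where \<open>\<alpha>\<close> is the quotient
  of the leading coefficients. By linear independence and
  the vanishing at 0, the polynomial in the exponent is nonconstant unless \<open>u = v = 0\<close>, so for
  \<open>p > d\<close> Weil's bound gives \<open>\<bar>T u v\<bar> \<le> d \<surd>p\<close>. The first and third pair can vanish only at \<open>s = 0\<close>,
  the second and fourth only at \<open>s = l \<alpha>\<close>. As \<open>l \<alpha> \<noteq> 0\<close>, at each of these two \<open>s\<close> at least two factors
  keep the Weil bound, whence \<open>p \<bar>S\<bar> \<le> p (d \<surd>p)^4 + 2 p^2 (d \<surd>p)^2\<close> (\<open>level_set_sum_bound\<close>). For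
  \<open>p \<le> d\<close>, counting the points of \<open>W\<close> suffices.

  Weil's bound itself is proved by Stepanov's method in the form of Bombieri. In an algebraically
  closed field of characteristic \<open>p\<close>, let \<open>S n\<close> be the character sum of \<open>Tr (f x)\<close> over the
  subfield \<open>GF n\<close> with \<open>p^n\<close> elements. Three facts are combined.

  \<^item> The L-function of \<open>f\<close> is a polynomial of degree below \<open>d = deg f\<close>. Its coefficients are sums
    over the monic polynomials over the prime field, which are viewed as Frobenius-stable multisets
    of roots. They satisfy a Newton recursion with the \<open>S n\<close> (\<open>L_coeff_rec\<close>) and vanish from the
    index \<open>d\<close> on (\<open>L_coeff_eq_0\<close>). Hence \<open>- S n\<close> is the \<open>n\<close>-th power sum of \<open>d - 1\<close> fixed
    complex numbers \<open>w\<close>.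

  \<^item> For even exponents, an auxiliary polynomial bounds the number of \<open>x\<close> with given trace
    of \<open>f x\<close> from above (\<open>trace_fibre_bound\<close>). The fibres together fill \<open>GF (2 m)\<close>, so an upper bound
    for each of them is also a lower bound, and \<open>S (2 m) = O(p^m)\<close> with a constant that does not
    depend on \<open>m\<close>.

  \<^item> Power sums of order \<open>O(p^m)\<close> for all \<open>m\<close> force \<open>\<bar>w^2\<bar> \<le> p\<close> (\<open>power_sum_bound\<close>). So
    \<open>\<bar>S 1\<bar> \<le> (d - 1) \<surd>p\<close> (\<open>weil_bound\<close>): the unspecified constant has disappeared.
\<close>

hide_const (open) Polynomials.degree Polynomials.lead_coeff

(* Keeps the prime field in the form GF 1. *)
declare One_nat_def [simp del]

section \<open>Newton identities\<close>

definition power_sum :: "'a::comm_ring_1 multiset \<Rightarrow> nat \<Rightarrow> 'a" where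
  "power_sum A k = (\<Sum>a\<in>#A. a ^ k)"

text \<open>
The generating function of the elementary symmetric functions, with signs. In contrast to the
monic polynomial with the same roots, its low coefficients do not depend on the size of the
multiset.
\<close>

definition elem_fps :: "'a::comm_ring_1 multiset \<Rightarrow> 'a fps" where
  "elem_fps A = (\<Prod>a\<in>#A. 1 - fps_const a * fps_X)"

lemma elem_fps_simps [simp]:
  "elem_fps {#} = 1" "elem_fps (add_mset x A) = (1 - fps_const x * fps_X) * elem_fps A"
  by (simp_all add: elem_fps_def)

lemma elem_fps_0 [simp]: "fps_nth (elem_fps A) 0 = 1"
  by (induction A) auto

text \<open>
The logarithmic derivative of the product \<open>G\<close> of the factors \<open>1 - a X\<close> is a sum of geometric
series: \<open>X G' = - G \<Sum>k\<ge>1. p_k X^k\<close> with the power sums \<open>p_k\<close>. Comparing coefficients gives the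
identity, in every characteristic.
\<close>

lemma newton_identity:
  fixes A :: "'a::comm_ring_1 multiset"
  shows "of_nat n * fps_nth (elem_fps A) n = - (\<Sum>k=1..n. power_sum A k * fps_nth (elem_fps A) (n - k))"
proof -
  define P where "P = (\<lambda>A::'a multiset. Abs_fps (\<lambda>k. if k = 0 then 0 else power_sum A k))"
  have eq: "fps_X * fps_deriv (elem_fps A) = - elem_fps A * P A"
  proof (induction A)
    case empty
    have "P {#} = 0" by (auto simp: P_def power_sum_def fps_eq_iff)
    then show ?case by simp
  next
    case (add b A)
    (* A new element b contributes the geometric series b X / (1 - b X) to P. *)
    have geo: "(1 - fps_const b * fps_X) * (P (add_mset b A) - P A) = fps_const b * fps_X"
    proof (rule fps_ext)
      fix n
      show "fps_nth ((1 - fps_const b * fps_X) * (P (add_mset b A) - P A)) n = fps_nth (fps_const b * fps_X) n"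
        by (cases n; cases "n - 1") (auto simp: P_def power_sum_def algebra_simps fps_X_nth mult.assoc)
    qed
    have "fps_X * fps_deriv (elem_fps (add_mset b A))
        = (1 - fps_const b * fps_X) * (fps_X * fps_deriv (elem_fps A)) - fps_const b * fps_X * elem_fps A"
      by (simp add: algebra_simps)
    also have "\<dots> = - (1 - fps_const b * fps_X) * elem_fps A * P A
        - (1 - fps_const b * fps_X) * (P (add_mset b A) - P A) * elem_fps A"
      unfolding geo add.IH by (simp add: algebra_simps)
    also have "\<dots> = - elem_fps (add_mset b A) * P (add_mset b A)"
      by (simp add: algebra_simps)
    finally show ?case .
  qed
  have "of_nat n * fps_nth (elem_fps A) n = fps_nth (fps_X * fps_deriv (elem_fps A)) n"
    by (simp add: fps_mult_fps_X_deriv_shift)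
  also have "\<dots> = - fps_nth (P A * elem_fps A) n"
    unfolding eq by (simp add: mult.commute)
  also have "\<dots> = - (\<Sum>k=0..n. fps_nth (P A) k * fps_nth (elem_fps A) (n - k))"
    by (simp add: fps_mult_nth)
  also have "(\<Sum>k=0..n. fps_nth (P A) k * fps_nth (elem_fps A) (n - k))
      = (\<Sum>k=1..n. power_sum A k * fps_nth (elem_fps A) (n - k))"
    by (rule sum.mono_neutral_cong_right) (auto simp: P_def)
  finally show ?thesis .
qed

lemma newton_power_sum:
  assumes "n > 0"
  shows "power_sum A n = - of_nat n * fps_nth (elem_fps A) n
            - (\<Sum>k=1..<n. power_sum A k * fps_nth (elem_fps A) (n - k))"
proof -
  have "{1..n} = insert n {1..<n}" using assms by auto
  thus ?thesis using newton_identity[of n A]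
    by (simp add: algebra_simps eq_neg_iff_add_eq_0)
qed

section \<open>Roots of split monic polynomials\<close>

definition linprod :: "'a::idom multiset \<Rightarrow> 'a poly" where
  "linprod A = (\<Prod>x\<in>#A. [:-x, 1:])"

lemma linprod_simps [simp]: "linprod {#} = 1" "linprod (add_mset x A) = [:-x, 1:] * linprod A"
  by (simp_all add: linprod_def)

lemma linprod_monic [simp]: "lead_coeff (linprod A) = 1"
  by (induction A) (auto simp: lead_coeff_mult simp del: mult_pCons_left)

lemma linprod_nonzero [simp]: "linprod A \<noteq> 0"
  using linprod_monic[of A] by fastforce

lemma degree_linprod [simp]: "degree (linprod A) = size A"
  by (induction A) (auto simp: degree_mult_eq simp del: mult_pCons_left)

lemma coeff_linprod_size [simp]: "coeff (linprod A) (size A) = 1"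
  using linprod_monic[of A] unfolding degree_linprod .

lemma proots_linprod [simp]: "proots (linprod A) = A"
  by (induction A) (auto simp: proots_mult simp del: mult_pCons_left)

lemma linprod_proots: "lead_coeff Q = 1 \<Longrightarrow> linprod (proots Q) = Q" for Q :: "'a::alg_closed_field poly"
proof -
  assume Q: "lead_coeff Q = 1"
  hence "Q \<noteq> 0" by auto
  then obtain A where "Q = linprod A"
    using alg_closed_imp_factorization[of Q] Q by (auto simp: linprod_def)
  thus ?thesis by simp
qed

lemma elem_fps_nth:
  fixes A :: "'a::idom multiset"
  shows "fps_nth (elem_fps A) k = (if k \<le> size A then coeff (linprod A) (size A - k) else 0)"
proof (induction A arbitrary: k)
  case empty
  show ?case by auto
next
  case (add x A)
  have hi: "coeff (linprod A) (Suc (size A)) = 0" by (simp add: coeff_eq_0)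
  show ?case
  proof (cases k)
    case 0
    have "coeff (linprod A) (size A) = 1" using linprod_monic[of A] by simp
    thus ?thesis using add.IH[of 0] by (simp add: 0 coeff_pCons hi)
  next
    case (Suc j)
    have "fps_nth (elem_fps (add_mset x A)) k = fps_nth (elem_fps A) k - x * fps_nth (elem_fps A) j"
      by (simp add: algebra_simps Suc mult.assoc)
    also have "\<dots> = (if k \<le> size (add_mset x A) then coeff (linprod (add_mset x A)) (size (add_mset x A) - k) else 0)"
    proof (cases "k \<le> size A")
      case True
      then obtain r where r: "size A = Suc j + r" using Suc le_Suc_ex by blast
      show ?thesis unfolding add.IH by (simp add: Suc r coeff_pCons)
    next
      case False
      show ?thesis unfolding add.IH using False Suc by (auto simp: coeff_pCons not_le split: nat.splits)
    qed
    finally show ?thesis .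
  qed
qed

text \<open>
The \<open>d\<close>-th power sum involves the \<open>d\<close>-th coefficient only through the term \<open>- d c_d\<close>, and the
earlier power sums do not involve it at all. This makes the effect of changing one coefficient of
a polynomial explicit, and is what kills the high coefficients of the L-function.
\<close>

lemma power_sum_shift:
  fixes A A' :: "'a::idom multiset"
  assumes A: "size A = n" "size A' = n" "linprod A' = linprod A + monom t (n - d)" and d: "0 < d" "d \<le> n"
  shows "0 < j \<Longrightarrow> j < d \<Longrightarrow> power_sum A' j = power_sum A j"
    and "power_sum A' d = power_sum A d - of_nat d * t"
proof -
  have el: "fps_nth (elem_fps A') k = fps_nth (elem_fps A) k + (if k = d then t else 0)" if "k \<le> n" for k
    unfolding elem_fps_nth A using that d by auto
  show lt: "power_sum A' j = power_sum A j" if "0 < j" "j < d" for j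
    using that
  proof (induction j rule: less_induct)
    case (less j)
    thus ?case
      using d by (auto simp: newton_power_sum[OF \<open>0 < j\<close>] el intro!: sum.cong)
  qed
  show "power_sum A' d = power_sum A d - of_nat d * t"
  proof -
    have "(\<Sum>k=1..<d. power_sum A' k * fps_nth (elem_fps A') (d - k))
        = (\<Sum>k=1..<d. power_sum A k * fps_nth (elem_fps A) (d - k))"
      by (rule sum.cong) (use d lt in \<open>auto simp: el\<close>)
    thus ?thesis using d by (simp add: newton_power_sum[OF d(1)] el algebra_simps)
  qed
qed

lemma sum_mset_poly: "(\<Sum>x\<in>#M. poly f x) = (\<Sum>j\<le>degree f. coeff f j * power_sum M j)"
  by (induction M) (auto simp: poly_altdef power_sum_def sum.distrib algebra_simps)

text \<open>
The recursion determines \<open>S\<close> from \<open>\<sigma>\<close>. The power sums of the reciprocal zeros of the polynomial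
\<open>\<Sum>i<d. \<sigma> i X^i\<close> satisfy the same recursion up to sign, so they are \<open>- S\<close>. Zero is allowed among
the \<open>d - 1\<close> numbers, since the polynomial may have degree below \<open>d - 1\<close>.
\<close>

lemma newton_inverse:
  fixes \<sigma> S :: "nat \<Rightarrow> complex"
  assumes d: "d > 0" and \<sigma>: "\<sigma> 0 = 1" "\<And>n. n \<ge> d \<Longrightarrow> \<sigma> n = 0"
    and rec: "\<And>n. of_nat n * \<sigma> n = (\<Sum>k=1..n. S k * \<sigma> (n - k))"
  shows "\<exists>A. size A = d - 1 \<and> (\<forall>k>0. S k = - power_sum A k)"
proof -
  define Q where "Q = (\<Sum>i<d. monom (\<sigma> i) (d - 1 - i))"
  have coeffQ: "coeff Q j = (if j < d then \<sigma> (d - 1 - j) else 0)" for j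
  proof -
    have "coeff Q j = (\<Sum>i<d. if i = d - 1 - j \<and> j < d then \<sigma> i else 0)"
      unfolding Q_def coeff_sum by (rule sum.cong) auto
    also have "\<dots> = (if j < d then \<sigma> (d - 1 - j) else 0)" using d by (auto simp: sum.delta)
    finally show ?thesis .
  qed
  have deg: "degree Q = d - 1"
    by (rule antisym[OF degree_le le_degree]) (use d \<sigma>(1) in \<open>auto simp: coeffQ\<close>)
  have "lead_coeff Q = 1" using d \<sigma>(1) by (simp add: deg coeffQ)
  define A where "A = proots Q"
  have lin: "linprod A = Q" unfolding A_def by (rule linprod_proots) fact
  have sz: "size A = d - 1" using degree_linprod[of A] by (simp add: lin deg)
  have el: "fps_nth (elem_fps A) k = \<sigma> k" for k
    using d \<sigma>(2)[of k] by (auto simp: elem_fps_nth lin sz coeffQ)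
  have "S k = - power_sum A k" if "k > 0" for k
    using that
  proof (induction k rule: less_induct)
    case (less n)
    have n: "{1..n} = insert n {1..<n}" using less.prems by auto
    have "S n = of_nat n * \<sigma> n - (\<Sum>k=1..<n. S k * \<sigma> (n - k))"
      using rec[of n] \<sigma>(1) by (simp add: n)
    also have "(\<Sum>k=1..<n. S k * \<sigma> (n - k)) = (\<Sum>k=1..<n. - power_sum A k * \<sigma> (n - k))"
      by (rule sum.cong) (use less.IH in auto)
    also have "of_nat n * \<sigma> n - \<dots> = - power_sum A n"
      unfolding newton_power_sum[OF less.prems] el by (simp add: sum_negf)
    finally show ?case .
  qed
  with sz show ?thesis by blast
qed

section \<open>Power sums of complex numbers\<close>

text \<open>
Cancellation between the powers is the only obstacle, and it is absent for infinitely many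
exponents: by the pigeonhole principle there are arbitrarily large \<open>j\<close> for which the \<open>j\<close>-th powers
of all directions \<open>sgn z\<close> are simultaneously close to 1. For these \<open>j\<close> the power sum is at least
half of \<open>\<bar>w\<bar>^j\<close>, and the constant \<open>K\<close> is lost in the limit.
\<close>

lemma power_sum_bound:
  fixes Z :: "complex multiset"
  assumes bound: "\<And>m. m \<ge> 1 \<Longrightarrow> cmod (\<Sum>z\<in>#Z. z ^ m) \<le> K * R ^ m" and R: "R > 0"
    and w: "w \<in># Z"
  shows "cmod w \<le> R"
proof (rule ccontr)
  assume "\<not> cmod w \<le> R"
  hence wR: "cmod w > R" by simp
  define u where "u = (\<lambda>z::complex. sgn z)"
  (* The cell of a grid of mesh 1/4 that contains the m-th power of each direction: two exponents
     of the same colour have m-th powers at distance at most 1/2. *)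
  define col where "col = (\<lambda>m. \<lambda>z\<in>set_mset Z. (\<lfloor>4 * Re (u z ^ m)\<rfloor>, \<lfloor>4 * Im (u z ^ m)\<rfloor>))"
  have un: "cmod (u z ^ m) \<le> 1" for z m
    by (simp add: u_def norm_power norm_sgn power_le_one)
  have "range col \<subseteq> set_mset Z \<rightarrow>\<^sub>E ({-4..4} \<times> {-4..4})"
  proof
    fix c assume "c \<in> range col"
    then obtain m where c: "c = col m" by auto
    have "\<lfloor>4 * Re (u z ^ m)\<rfloor> \<in> {-4..4} \<and> \<lfloor>4 * Im (u z ^ m)\<rfloor> \<in> {-4..4}" for z
    proof -
      have "\<bar>Re (u z ^ m)\<bar> \<le> 1" "\<bar>Im (u z ^ m)\<bar> \<le> 1"
        using un[of z m] abs_Re_le_cmod[of "u z ^ m"] abs_Im_le_cmod[of "u z ^ m"] by linarith+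
      thus ?thesis by (auto simp: le_floor_iff floor_le_iff)
    qed
    thus "c \<in> set_mset Z \<rightarrow>\<^sub>E ({-4..4} \<times> {-4..4})" unfolding c col_def by auto
  qed
  hence "finite (range col)" by (rule finite_subset) (auto intro: finite_PiE)
  from pigeonhole_infinite[OF infinite_UNIV_nat this] obtain m0 where inf: "infinite {m. col m = col m0}"
    by auto
  have close: "Re (u z ^ (m - m0)) \<ge> 1/2" if "z \<in># Z" "z \<noteq> 0" "col m = col m0" "m > m0" for z m
  proof -
    have n1: "cmod (u z) = 1" using that by (simp add: u_def norm_sgn)
    have eq: "\<lfloor>4 * Re (u z ^ m)\<rfloor> = \<lfloor>4 * Re (u z ^ m0)\<rfloor>" "\<lfloor>4 * Im (u z ^ m)\<rfloor> = \<lfloor>4 * Im (u z ^ m0)\<rfloor>"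
      using fun_cong[OF that(3), of z] that(1) by (auto simp: col_def)
    have fl: "\<bar>a - b\<bar> \<le> 1/4" if "\<lfloor>4 * a\<rfloor> = \<lfloor>4 * b\<rfloor>" for a b :: real
      using floor_correct[of "4 * a"] floor_correct[of "4 * b"] that by linarith
    have "\<bar>Re (u z ^ m - u z ^ m0)\<bar> \<le> 1/4" "\<bar>Im (u z ^ m - u z ^ m0)\<bar> \<le> 1/4"
      using fl[OF eq(1)] fl[OF eq(2)] by simp_all
    hence "cmod (u z ^ m - u z ^ m0) \<le> 1/2" using cmod_le[of "u z ^ m - u z ^ m0"] by linarith
    also have "u z ^ m - u z ^ m0 = u z ^ m0 * (u z ^ (m - m0) - 1)"
      using that(4) by (simp add: algebra_simps flip: power_add)
    also have "cmod \<dots> = cmod (u z ^ (m - m0) - 1)" by (simp add: norm_mult norm_power n1)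
    finally have "cmod (1 - u z ^ (m - m0)) \<le> 1/2" by (simp add: norm_minus_commute)
    with complex_Re_le_cmod[of "1 - u z ^ (m - m0)"] show ?thesis by simp
  qed
  have main: "cmod w ^ j \<le> 2 * K * R ^ j" if "col m = col m0" "m > m0" "j = m - m0" for m j
  proof -
    have each: "Re (z ^ j) \<ge> cmod z ^ j / 2" if "z \<in># Z" for z
    proof (cases "z = 0")
      case True
      thus ?thesis using \<open>m > m0\<close> \<open>j = m - m0\<close> by (simp add: power_0_left)
    next
      case False
      have "z = of_real (cmod z) * u z" using False by (simp add: u_def sgn_eq)
      hence "z ^ j = of_real (cmod z ^ j) * u z ^ j" by (metis of_real_power power_mult_distrib)
      hence "Re (z ^ j) = cmod z ^ j * Re (u z ^ j)" by simp
      also have "\<dots> \<ge> cmod z ^ j * (1/2)"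
        using close[OF that False \<open>col m = col m0\<close> \<open>m > m0\<close>] \<open>j = m - m0\<close> by (intro mult_left_mono) auto
      finally show ?thesis by simp
    qed
    have "cmod w ^ j / 2 \<le> (\<Sum>z\<in>#Z. cmod z ^ j / 2)"
    proof -
      obtain Z' where "Z = add_mset w Z'" using w by (metis insert_DiffM)
      moreover have "0 \<le> (\<Sum>z\<in>#Z'. cmod z ^ j / 2)" by (induction Z') auto
      ultimately show ?thesis by simp
    qed
    also have "\<dots> \<le> (\<Sum>z\<in>#Z. Re (z ^ j))" by (rule sum_mset_mono) (use each in auto)
    also have "\<dots> = Re (\<Sum>z\<in>#Z. z ^ j)" by (induction Z) auto
    also have "\<dots> \<le> cmod (\<Sum>z\<in>#Z. z ^ j)" by (rule complex_Re_le_cmod)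
    also have "\<dots> \<le> K * R ^ j" using that by (intro bound) auto
    finally show ?thesis by simp
  qed
  (* cmod w / R > 1 would make the left side of main outgrow 2 K. *)
  have "1 < cmod w / R" using wR R by simp
  from real_arch_pow[OF this, of "2 * K"] obtain j0 where j0: "2 * K < (cmod w / R) ^ j0" by auto
  from inf obtain m where m: "m > m0 + j0" "col m = col m0"
    by (metis (mono_tags, lifting) infinite_nat_iff_unbounded mem_Collect_eq)
  define j where "j = m - m0"
  have "(cmod w / R) ^ j \<le> 2 * K" using main[OF m(2) _ j_def] m R by (simp add: power_divide field_simps)
  moreover have "(cmod w / R) ^ j0 \<le> (cmod w / R) ^ j" 
    using m \<open>1 < cmod w / R\<close> by (intro power_increasing) (auto simp: j_def)
  ultimately show False using j0 by simp
qed

section \<open>Finite subfields and the Frobenius map\<close>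

definition GF :: "nat \<Rightarrow> 'a::field_prime_char set" where
  "GF n = {x. x ^ (CHAR('a) ^ n) = x}"

lemma frob_add: "(x + y) ^ (CHAR('a) ^ n) = x ^ (CHAR('a) ^ n) + y ^ (CHAR('a) ^ n)"
  for x y :: "'a::field_prime_char"
  by (rule freshmans_dream') auto

lemma frob_sum: "(\<Sum>i\<in>A. g i) ^ (CHAR('a) ^ n) = (\<Sum>i\<in>A. g i ^ (CHAR('a) ^ n))"
  for g :: "'b \<Rightarrow> 'a::field_prime_char"
  by (rule freshmans_dream_sum') auto

lemma frob_uminus: "(- x) ^ (CHAR('a) ^ n) = - (x ^ (CHAR('a) ^ n))"
  for x :: "'a::field_prime_char"
proof (induction n)
  case (Suc n)
  have "(- x) ^ (CHAR('a) ^ Suc n) = ((- x) ^ (CHAR('a) ^ n)) ^ CHAR('a)"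
    by (simp add: mult.commute flip: power_mult)
  also have "\<dots> = - (x ^ (CHAR('a) ^ Suc n))"
    by (simp add: Suc.IH minus_power_prime_CHAR mult.commute flip: power_mult)
  finally show ?case .
qed auto

lemma frob_diff: "(x - y) ^ (CHAR('a) ^ n) = x ^ (CHAR('a) ^ n) - y ^ (CHAR('a) ^ n)"
  for x y :: "'a::field_prime_char"
  using frob_add[of x "- y" n] frob_uminus[of y n] by simp

lemma frob_inj: "x ^ (CHAR('a) ^ n) = y ^ (CHAR('a) ^ n) \<longleftrightarrow> x = y"
  for x y :: "'a::field_prime_char"
proof
  assume "x ^ (CHAR('a) ^ n) = y ^ (CHAR('a) ^ n)"
  hence "(x - y) ^ (CHAR('a) ^ n) = 0" by (simp add: frob_diff)
  thus "x = y" by simp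
qed simp

lemma GF_0 [simp]: "0 \<in> GF n" and GF_1 [simp]: "1 \<in> GF n"
  by (auto simp: GF_def power_0_left)

lemma GF_add [intro]: "x \<in> GF n \<Longrightarrow> y \<in> GF n \<Longrightarrow> x + y \<in> GF n"
  and GF_diff [intro]: "x \<in> GF n \<Longrightarrow> y \<in> GF n \<Longrightarrow> x - y \<in> GF n"
  and GF_uminus [intro]: "x \<in> GF n \<Longrightarrow> - x \<in> GF n"
  and GF_mult [intro]: "x \<in> GF n \<Longrightarrow> y \<in> GF n \<Longrightarrow> x * y \<in> GF n"
  and GF_inverse [intro]: "x \<in> GF n \<Longrightarrow> inverse x \<in> GF n"
  by (auto simp: GF_def frob_add frob_diff frob_uminus power_mult_distrib power_inverse)

lemma GF_sum [intro]: "(\<And>i. i \<in> A \<Longrightarrow> g i \<in> GF n) \<Longrightarrow> (\<Sum>i\<in>A. g i) \<in> GF n"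
  by (induction A rule: infinite_finite_induct) auto

lemma GF_of_nat [simp]: "of_nat k \<in> GF n"
  by (induction k) auto

lemma GF_of_int [simp]: "of_int k \<in> GF n"
  by (cases k rule: int_cases2) auto

lemma frob_frob: "(x ^ (CHAR('a) ^ m)) ^ (CHAR('a) ^ n) = x ^ (CHAR('a) ^ (m + n))"
  for x :: "'a::field_prime_char"
  by (simp add: power_add flip: power_mult)

lemma GF_dvd: "x \<in> GF m \<Longrightarrow> m dvd n \<Longrightarrow> x \<in> GF n"
proof -
  have "x \<in> GF (m * k)" if "x \<in> GF m" for k
  proof (induction k)
    case 0
    show ?case by (simp add: GF_def)
  next
    case (Suc k)
    thus ?case using that frob_frob[of x m "m * k"] by (simp add: GF_def)
  qed
  thus "x \<in> GF m \<Longrightarrow> m dvd n \<Longrightarrow> x \<in> GF n" by (auto elim!: dvdE)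
qed

text \<open>
The polynomial \<open>X^q - X\<close> is separable, because its derivative is \<open>- 1\<close>.
\<close>

lemma
  fixes ty :: "'a::{alg_closed_field,field_prime_char} itself"
  assumes "n > 0"
  shows finite_GF: "finite (GF n :: 'a set)" and card_GF: "card (GF n :: 'a set) = CHAR('a) ^ n"
proof -
  define q where "q = CHAR('a) ^ n"
  have q: "q > 1" unfolding q_def using assms prime_gt_1_nat[OF CHAR_prime[where ?'a='a]] by (intro one_less_power)
  define Q where "Q = (monom 1 q - monom 1 1 :: 'a poly)"
  have deg: "degree Q = q" unfolding Q_def using q
    unfolding diff_conv_add_uminus by (subst degree_add_eq_left) (auto simp: degree_monom_eq)
  have Q0: "Q \<noteq> 0" using deg q by auto
  have roots: "{x. poly Q x = 0} = (GF n :: 'a set)"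
    by (auto simp: Q_def GF_def poly_monom q_def)
  have "(of_nat q :: 'a) = 0" using assms by (simp add: q_def)
  hence pd: "pderiv Q = -1"
    by (simp add: Q_def pderiv_diff pderiv_monom one_pCons monom_0)
  have "order x Q \<le> 1" for x
  proof (rule ccontr)
    assume "\<not> order x Q \<le> 1"
    hence "[:-x, 1:] ^ 2 dvd Q" by (subst order_divides) auto
    then obtain r where "Q = [:-x, 1:] ^ 2 * r" by (elim dvdE)
    hence "poly (pderiv Q) x = 0" by (simp only: pderiv_mult power2_eq_square poly_add poly_mult) simp
    thus False by (simp add: pd)
  qed
  have lin: "linprod (proots Q) = Q"
    using deg q by (intro linprod_proots) (simp add: Q_def)
  have size: "size (proots Q) = q"
    using degree_linprod[of "proots Q"] by (simp add: lin deg)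
  have fin: "finite (GF n :: 'a set)" using roots poly_roots_finite[OF Q0] by simp
  have "proots Q = mset_set (GF n)"
  proof (rule multiset_eqI)
    fix x
    have "order x Q = 0 \<longleftrightarrow> x \<notin> GF n"
      using roots order_root[of Q x] Q0 by auto
    with \<open>order x Q \<le> 1\<close> have "order x Q = (if x \<in> GF n then 1 else 0)" by (cases "order x Q") auto
    thus "count (proots Q) x = count (mset_set (GF n)) x" using fin Q0 by simp
  qed
  with size show "card (GF n :: 'a set) = CHAR('a) ^ n" by (simp add: q_def)
  show "finite (GF n :: 'a set)" by (rule fin)
qed

lemma GF_1_eq: "(GF 1 :: 'a::{alg_closed_field,field_prime_char} set) = of_nat ` {..<CHAR('a)}"
proof -
  have inj: "inj_on (of_nat :: nat \<Rightarrow> 'a) {..<CHAR('a)}"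
    by (rule inj_onI) (auto simp: of_nat_eq_iff_cong_CHAR cong_def)
  show ?thesis
    by (rule sym, rule card_subset_eq) (auto simp: finite_GF card_GF card_image[OF inj])
qed

text \<open>
Polynomials over the prime field, inside the polynomials over the large field.
\<close>

definition prime_coeffs :: "'a::field_prime_char poly \<Rightarrow> bool" where
  "prime_coeffs Q \<longleftrightarrow> (\<forall>i. coeff Q i \<in> GF 1)"

lemma GF_frob: "c \<in> GF 1 \<Longrightarrow> c ^ (CHAR('a) ^ n) = c" for c :: "'a::field_prime_char"
  using GF_dvd[of c 1 n] by (simp add: GF_def)

lemma prime_coeffs_frob:
  fixes x :: "'a::field_prime_char"
  assumes "prime_coeffs Q"
  shows "poly Q (x ^ (CHAR('a) ^ n)) = poly Q x ^ (CHAR('a) ^ n)"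
proof -
  have "poly Q x ^ (CHAR('a) ^ n) = (\<Sum>i\<le>degree Q. (coeff Q i * x ^ i) ^ (CHAR('a) ^ n))"
    by (simp add: poly_altdef frob_sum)
  also have "\<dots> = (\<Sum>i\<le>degree Q. coeff Q i * (x ^ (CHAR('a) ^ n)) ^ i)"
    using assms by (simp add: prime_coeffs_def power_mult_distrib GF_frob power_commutes mult.commute flip: power_mult)
  finally show ?thesis by (simp add: poly_altdef)
qed

lemma prime_coeffs_poly: "prime_coeffs Q \<Longrightarrow> x \<in> GF n \<Longrightarrow> poly Q x \<in> GF n"
  using prime_coeffs_frob[of Q x n] by (simp add: GF_def)

lemma prime_coeffs_intros [intro]:
  "prime_coeffs 0" "prime_coeffs 1"
  "c \<in> GF 1 \<Longrightarrow> prime_coeffs [:c:]"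
  "c \<in> GF 1 \<Longrightarrow> prime_coeffs (monom c n)"
  "prime_coeffs Q \<Longrightarrow> prime_coeffs R \<Longrightarrow> prime_coeffs (Q + R)"
  "prime_coeffs Q \<Longrightarrow> prime_coeffs R \<Longrightarrow> prime_coeffs (Q - R)"
  "prime_coeffs Q \<Longrightarrow> prime_coeffs R \<Longrightarrow> prime_coeffs (Q * R)"
  "c \<in> GF 1 \<Longrightarrow> prime_coeffs Q \<Longrightarrow> prime_coeffs (smult c Q)"
  by (auto simp: prime_coeffs_def coeff_mult one_pCons coeff_pCons split: nat.splits)

lemma prime_coeffs_power [intro]: "prime_coeffs Q \<Longrightarrow> prime_coeffs (Q ^ n)"
  by (induction n) auto

lemma prime_coeffs_sum [intro]: "(\<And>i. i \<in> A \<Longrightarrow> prime_coeffs (g i)) \<Longrightarrow> prime_coeffs (\<Sum>i\<in>A. g i)"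
  by (induction A rule: infinite_finite_induct) auto

definition frob_trace :: "nat \<Rightarrow> 'a::field_prime_char \<Rightarrow> 'a" where
  "frob_trace n y = (\<Sum>i<n. y ^ (CHAR('a) ^ i))"

lemma frob_trace_GF: 
  assumes "y \<in> GF n" "n > 0"
  shows "frob_trace n y \<in> GF 1"
proof -
  have "frob_trace n y ^ (CHAR('a) ^ 1) = (\<Sum>i<n. y ^ (CHAR('a) ^ Suc i))"
    by (simp only: frob_trace_def frob_sum frob_frob Suc_eq_plus1)
  also have "\<dots> + y = (\<Sum>i<Suc n. y ^ (CHAR('a) ^ i))" by (subst sum.lessThan_Suc_shift) simp
  also have "\<dots> = frob_trace n y + y" using assms by (simp add: frob_trace_def GF_def)
  finally show ?thesis by (simp add: GF_def)
qed

lemma frob_trace_1 [simp]: "frob_trace 1 y = y"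
  unfolding frob_trace_def One_nat_def by simp

section \<open>Points of given trace\<close>

text \<open>
The leading term of the summand of highest degree cannot cancel.
\<close>

lemma sum_distinct_degrees_nonzero:
  fixes g :: "'i \<Rightarrow> 'a::idom poly"
  assumes "finite I" and inj: "inj_on (\<lambda>t. degree (g t)) I" and nz: "\<And>t. t \<in> I \<Longrightarrow> g t \<noteq> 0"
    and "t0 \<in> I" "a t0 \<noteq> 0"
  shows "(\<Sum>t\<in>I. smult (a t) (g t)) \<noteq> 0"
proof -
  define J where "J = {t \<in> I. a t \<noteq> 0}"
  have J: "finite J" "J \<noteq> {}" using assms by (auto simp: J_def)
  have "Max ((\<lambda>t. degree (g t)) ` J) \<in> (\<lambda>t. degree (g t)) ` J" using J by (intro Max_in) auto
  then obtain s where s: "s \<in> J" "degree (g s) = Max ((\<lambda>t. degree (g t)) ` J)" by auto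
  have other: "a t * coeff (g t) (degree (g s)) = 0" if "t \<in> I - {s}" for t
  proof (cases "t \<in> J")
    case True
    hence "degree (g t) \<le> degree (g s)" unfolding s(2) using J by auto
    moreover have "degree (g t) \<noteq> degree (g s)"
      using inj that s(1) by (auto simp: inj_on_def J_def)
    ultimately show ?thesis by (simp add: coeff_eq_0)
  qed (use that in \<open>auto simp: J_def\<close>)
  have "coeff (\<Sum>t\<in>I. smult (a t) (g t)) (degree (g s)) = (\<Sum>t\<in>I. a t * coeff (g t) (degree (g s)))"
    by (simp add: coeff_sum)
  also have "\<dots> = a s * lead_coeff (g s)"
    using s(1) sum.neutral[of "I - {s}", OF ballI[OF other]] \<open>finite I\<close>
    by (subst sum.remove[of _ s]) (auto simp: J_def)
  also have "\<dots> \<noteq> 0" using s(1) nz[of s] by (auto simp: J_def)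
  finally show ?thesis by auto
qed

text \<open>
A linear dependency over the prime field, by counting: there are \<open>p^card I\<close> coefficient vectors, but
at most \<open>p^E\<close> polynomials of degree below \<open>E\<close> over the prime field. Keeping the scalars in the prime
field matters because they have to be fixed by Frobenius later.
\<close>

lemma prime_coeffs_kernel:
  fixes U :: "'i \<Rightarrow> 'a::{alg_closed_field,field_prime_char} poly"
  assumes I: "finite I" and U: "\<And>t. t \<in> I \<Longrightarrow> prime_coeffs (U t)" "\<And>t. t \<in> I \<Longrightarrow> degree (U t) < E"
    and "E < card I"
  shows "\<exists>a. (\<forall>t\<in>I. a t \<in> GF 1) \<and> (\<exists>t\<in>I. a t \<noteq> 0) \<and> (\<Sum>t\<in>I. smult (a t) (U t)) = 0"
proof -
  define F where "F = (GF 1 :: 'a set)"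
  define A where "A = (I \<rightarrow>\<^sub>E F)"
  define V where "V = (\<lambda>a. \<Sum>t\<in>I. smult (a t) (U t))"
  define \<Phi> where "\<Phi> = (\<lambda>a. \<lambda>k\<in>{..<E}. coeff (V a) k)"
  have F: "finite F" "card F = CHAR('a)" unfolding F_def by (auto simp: finite_GF card_GF)
  have "\<Phi> ` A \<subseteq> ({..<E} \<rightarrow>\<^sub>E F)"
  proof (rule image_subsetI)
    fix a assume a: "a \<in> A"
    have "prime_coeffs (V a)" unfolding V_def using a U
      by (auto simp: A_def F_def PiE_iff intro!: prime_coeffs_sum prime_coeffs_intros)
    thus "\<Phi> a \<in> ({..<E} \<rightarrow>\<^sub>E F)" by (auto simp: \<Phi>_def prime_coeffs_def F_def)
  qed
  hence "card (\<Phi> ` A) \<le> card ({..<E} \<rightarrow>\<^sub>E F)" by (intro card_mono) (auto intro: finite_PiE F)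
  also have "\<dots> = CHAR('a) ^ E" by (simp add: card_PiE F)
  also have "\<dots> < CHAR('a) ^ card I"
    using \<open>E < card I\<close> prime_gt_1_nat[OF CHAR_prime[where ?'a='a]] by (intro power_strict_increasing) auto
  also have "\<dots> = card A" using I by (simp add: A_def card_PiE F)
  finally have "\<not> inj_on \<Phi> A" by (rule pigeonhole)
  then obtain a1 a2 where a: "a1 \<in> A" "a2 \<in> A" "a1 \<noteq> a2" "\<Phi> a1 = \<Phi> a2" by (auto simp: inj_on_def)
  have "\<exists>t\<in>I. a1 t \<noteq> a2 t" using a(1-3) unfolding A_def by (metis PiE_ext)
  moreover have "V (\<lambda>t. a1 t - a2 t) = 0"
  proof (rule poly_eqI)
    fix k
    have V: "V (\<lambda>t. a1 t - a2 t) = V a1 - V a2"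
      by (simp add: V_def smult_diff_left sum_subtractf)
    have "coeff (V a') k = 0" if "k \<ge> E" for a'
      unfolding V_def coeff_sum using U(2) that by (intro sum.neutral) (auto intro!: coeff_eq_0 dest: order.strict_trans2)
    moreover have "coeff (V a1) k = coeff (V a2) k" if "k < E"
      using fun_cong[OF a(4), of k] that by (simp add: \<Phi>_def)
    ultimately show "coeff (V (\<lambda>t. a1 t - a2 t)) k = coeff 0 k" unfolding V by (cases "k < E") auto
  qed
  ultimately show ?thesis
    using a(1,2) by (intro exI[of _ "\<lambda>t. a1 t - a2 t"]) (auto simp: V_def A_def F_def PiE_iff)
qed

text \<open>
The remainder modulo \<open>R\<close> recovers \<open>k\<close>. Then \<open>p i + d j\<close> modulo \<open>p\<close> recovers \<open>j < p\<close>, as \<open>d\<close> is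
invertible there.
\<close>

lemma stepanov_weights_distinct:
  fixes p d R i j k i' j' k' :: nat
  assumes eq: "k + (p * R) * i + j * (d * R) = k' + (p * R) * i' + j' * (d * R)"
    and "coprime p d" "k < R" "k' < R" "j < p" "j' < p"
  shows "i = i' \<and> j = j' \<and> k = k'"
proof -
  have R: "k + R * (p * i + d * j) = k' + R * (p * i' + d * j')" using eq by (simp add: algebra_simps)
  hence "(k + R * (p * i + d * j)) mod R = (k' + R * (p * i' + d * j')) mod R" by simp
  hence k: "k = k'" using assms by simp
  with R have e: "p * i + d * j = p * i' + d * j'" using assms by simp
  hence "[p * i + d * j = p * i' + d * j'] (mod p)" by simp
  hence "[d * j = d * j'] (mod p)" by (simp add: cong_def)
  hence "[j = j'] (mod p)" using \<open>coprime p d\<close> by (simp add: cong_mult_lcancel_nat coprime_commute)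
  hence "j = j'" using assms by (simp add: cong_def)
  with e k show ?thesis using assms by auto
qed

lemma sum_lessThan_add: "(\<Sum>i<m + n. g i) = (\<Sum>i<m. g i) + (\<Sum>i<n. g (i + m) :: 'a::comm_monoid_add)" for m n :: nat
  by (induction n) (auto simp: add_ac)

text \<open>
Put \<open>P = p^m\<close>, so that \<open>x^(P P) = x\<close> on \<open>GF (2 m)\<close>, and let \<open>h\<close> be the half trace
\<open>\<Sum>i<m. f^(p^i)\<close>. The full trace of \<open>f x\<close> is \<open>h + h^P\<close>, so on the fibre over \<open>c\<close> the Frobenius power
\<open>h^P\<close> equals \<open>c - h\<close>. The auxiliary polynomial is a combination
\<open>T = \<Sum> a(i,j,k) X^(k + P i) h^j\<close> over the prime field. On the fibre, \<open>T^P\<close> agrees with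
\<open>\<Sum> a(i,j,k) X^(P k + i) (c - h)^j\<close>, whose degree is below the number of coefficients
\<open>a(i,j,k)\<close>, so that a nontrivial choice of them makes it zero. Then \<open>T\<close> vanishes on the whole fibre, while the
degrees of the terms of \<open>T\<close> are distinct, so \<open>T \<noteq> 0\<close> and the fibre has at most \<open>deg T\<close> elements.
Distinctness is where \<open>p\<close> not dividing \<open>deg f\<close> enters.
\<close>

lemma trace_fibre_bound:
  fixes f :: "'a::{alg_closed_field,field_prime_char} poly"
  assumes f: "prime_coeffs f" and pd: "\<not> CHAR('a) dvd degree f" and m: "m > 0" and c: "c \<in> GF 1"
  shows "card {x \<in> GF (2 * m). frob_trace (2 * m) (poly f x) = c}
    \<le> CHAR('a) ^ (2 * m - 1) + (3 * degree f + 1) * CHAR('a) ^ m"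
proof -
  define p d where "p = CHAR('a)" and "d = degree f"
  (* h has degree d R, hence k < R and j < p are the ranges that keep the degrees apart. The excess b
     of the range of i over R is chosen to leave more unknowns than equations. *)
  define R P b where "R = p ^ (m - 1)" and "P = p ^ m" and "b = 2 * d + 1"
  have p: "prime p" "p > 1" unfolding p_def using prime_gt_1_nat[OF CHAR_prime[where ?'a='a]] by auto
  have P: "P = p * R" unfolding P_def R_def using m by (metis power_eq_if less_numeral_extra(3))
  have R0: "R > 0" using p by (simp add: R_def)
  have "2 * R \<le> p * R" using p by (intro mult_le_mono1) simp
  hence PR: "P \<ge> 2 * R" by (simp add: P)
  with R0 have RP: "R > 0" "P \<ge> 2 * R" "P \<ge> 2" by linarith+
  have d: "d > 0" using pd unfolding d_def by (cases "degree f") auto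
  have cop: "coprime p d" using pd p unfolding d_def p_def by (simp add: prime_imp_coprime)
  have f0: "f \<noteq> 0" using d by (auto simp: d_def)
  define h where "h = (\<Sum>i<m. f ^ (p ^ i))"
  have h_tr: "poly h x = frob_trace m (poly f x)" for x
    by (simp add: h_def frob_trace_def p_def poly_sum)
  have tr2: "frob_trace (2 * m) y = frob_trace m y + frob_trace m y ^ P" for y :: 'a
  proof -
    have "frob_trace m y ^ P = (\<Sum>i<m. y ^ (p ^ (i + m)))"
      unfolding P_def p_def frob_trace_def frob_sum frob_frob ..
    moreover have "(\<Sum>i<m + m. y ^ (p ^ i)) = (\<Sum>i<m. y ^ (p ^ i)) + (\<Sum>i<m. y ^ (p ^ (i + m)))"
      by (rule sum_lessThan_add)
    ultimately show ?thesis by (simp add: frob_trace_def p_def mult_2)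
  qed
  have h_pc: "prime_coeffs h" unfolding h_def using f by auto
  have h_deg: "degree h = d * R"
  proof -
    have "degree (f ^ (p ^ i)) < d * R" if "i < m - 1" for i
      using that p d f0 by (simp add: degree_power_eq d_def R_def)
    hence "degree (\<Sum>i<m - 1. f ^ (p ^ i)) < d * R" using d RP by (intro degree_sum_less) auto
    moreover have "degree (f ^ R) = d * R" using f0 by (simp add: degree_power_eq d_def)
    moreover have "h = (\<Sum>i<m - 1. f ^ (p ^ i)) + f ^ R"
      using m unfolding h_def R_def by (cases m) auto
    ultimately show ?thesis by (simp add: degree_add_eq_right)
  qed
  have h0: "h \<noteq> 0" using h_deg d RP by auto
  define I where "I = {..<R + b} \<times> {..<p} \<times> {..<R}"
  define g where "g = (\<lambda>(i,j,k). monom (1::'a) (k + P * i) * h ^ j)"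
  define U where "U = (\<lambda>(i,j,k). monom (1::'a) (P * k + i) * ([:c:] - h) ^ j)"
  (* An upper bound for the degrees of the U t, while there are P R + b P unknowns. *)
  define E where "E = P * R + b + d * P"
  have jdR: "j * (d * R) + d * R \<le> d * P" if "j < p" for j
  proof -
    have "(j + 1) * (d * R) \<le> p * (d * R)" using that by (intro mult_le_mono1) simp
    thus ?thesis by (simp add: P algebra_simps)
  qed
  have kP: "P * k + P \<le> P * R" if "k < R" for k
  proof -
    have "P * (k + 1) \<le> P * R" using that by (intro mult_le_mono2) simp
    thus ?thesis by (simp only: distrib_left mult_1_right)
  qed
  have deg_g: "degree (g (i,j,k)) = k + P * i + j * (d * R)" for i j k
    using h0 by (simp add: g_def degree_mult_eq degree_monom_eq degree_power_eq h_deg)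
  have g0: "g t \<noteq> 0" for t using h0 by (cases t) (auto simp: g_def)
  have inj: "inj_on (\<lambda>t. degree (g t)) I"
  proof (rule inj_onI)
    fix t t' assume *: "t \<in> I" "t' \<in> I" "degree (g t) = degree (g t')"
    obtain i j k i' j' k' where t: "t = (i,j,k)" "t' = (i',j',k')" by (cases t, cases t')
    show "t = t'"
      using stepanov_weights_distinct[of k p R i j d k' i' j'] * cop by (simp add: t deg_g I_def P)
  qed
  have deg_U: "degree (U t) < E" if "t \<in> I" for t
  proof -
    obtain i j k where t: "t = (i,j,k)" by (cases t)
    have lt: "i < R + b" "j < p" "k < R" using that by (auto simp: I_def t)
    have "degree ([:c:] - h) \<le> d * R" by (rule degree_diff_le) (auto simp: h_deg)
    have "degree (([:c:] - h) ^ j) \<le> degree ([:c:] - h) * j" by (rule degree_power_le)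
    also have "\<dots> \<le> (d * R) * j" by (rule mult_le_mono1) fact
    also have "\<dots> = j * (d * R)" by (rule mult.commute)
    finally have "degree (([:c:] - h) ^ j) \<le> j * (d * R)" .
    hence "degree (U t) \<le> (P * k + i) + j * (d * R)"
      unfolding U_def t using degree_mult_le[of "monom (1::'a) (P * k + i)" "([:c:] - h) ^ j"]
      by (simp add: degree_monom_eq)
    also have "\<dots> < E" using kP[OF lt(3)] jdR[OF lt(2)] lt(1) RP by (simp add: E_def)
    finally show ?thesis .
  qed
  have U_pc: "prime_coeffs (U t)" for t
    using c h_pc by (cases t) (auto simp: U_def intro!: prime_coeffs_intros prime_coeffs_power)
  have "b * P > b + d * P"
  proof -
    obtain P' where P': "P = P' + 2" using RP(3) by (metis le_add_diff_inverse2)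
    show ?thesis unfolding b_def P' by (simp add: algebra_simps)
  qed
  moreover have "card I = (R + b) * P" by (simp add: I_def P)
  ultimately have EI: "E < card I" by (simp add: E_def algebra_simps)
  have finI: "finite I" by (simp add: I_def)
  have "\<exists>a. (\<forall>t\<in>I. a t \<in> GF 1) \<and> (\<exists>t\<in>I. a t \<noteq> 0) \<and> (\<Sum>t\<in>I. smult (a t) (U t)) = 0"
    using U_pc deg_U by (intro prime_coeffs_kernel[OF finI _ _ EI])
  then obtain a where
    a: "\<forall>t\<in>I. a t \<in> GF 1" "\<exists>t\<in>I. a t \<noteq> 0" "(\<Sum>t\<in>I. smult (a t) (U t)) = 0"
    by (elim exE conjE)
  define T where "T = (\<Sum>t\<in>I. smult (a t) (g t))"
  have T0: "T \<noteq> 0"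
    unfolding T_def using a(2) sum_distinct_degrees_nonzero[OF finI inj g0] by blast
  have deg_T: "degree T \<le> P * R + (3 * d + 1) * P"
    unfolding T_def
  proof (rule degree_sum_le)
    fix t assume "t \<in> I"
    obtain i j k where t: "t = (i,j,k)" by (cases t)
    have lt: "i < R + b" "j < p" "k < R" using \<open>t \<in> I\<close> by (auto simp: I_def t)
    have "P * (i + 1) \<le> P * (R + b)" using lt by (intro mult_le_mono2) simp
    hence "degree (g t) \<le> P * R + (3 * d + 1) * P"
      using jdR[OF lt(2)] lt(3) RP unfolding t deg_g b_def by (simp add: algebra_simps)
    thus "degree (smult (a t) (g t)) \<le> P * R + (3 * d + 1) * P"
      using degree_smult_le order_trans by blast
  qed (auto simp: I_def)
  have zero: "poly T x = 0" if x: "x \<in> GF (2 * m)" "frob_trace (2 * m) (poly f x) = c" for x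
  proof -
    have hP: "poly h x ^ P = c - poly h x" using x(2) unfolding h_tr tr2 by (simp add: algebra_simps)
    have xPP: "x ^ (P * P) = x" using x(1) by (simp add: GF_def P_def p_def power_add mult_2)
    have gU: "poly (g t) x ^ P = poly (U t) x" for t
    proof -
      obtain i j k where t: "t = (i,j,k)" by (cases t)
      have "poly (g t) x ^ P = (x ^ (k + P * i) * poly h x ^ j) ^ P"
        by (simp add: t g_def poly_monom)
      also have "\<dots> = x ^ ((k + P * i) * P) * poly h x ^ (j * P)"
        by (simp only: power_mult_distrib power_mult)
      also have "(k + P * i) * P = P * k + (P * P) * i" by (simp add: algebra_simps)
      also have "j * P = P * j" by simp
      also have "x ^ (P * k + (P * P) * i) * poly h x ^ (P * j) = x ^ (P * k) * (x ^ (P * P)) ^ i * (poly h x ^ P) ^ j"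
        by (simp only: power_add power_mult)
      also have "\<dots> = poly (U t) x" unfolding hP xPP by (simp add: t U_def poly_monom power_add)
      finally show ?thesis .
    qed
    have "poly T x ^ P = (\<Sum>t\<in>I. (a t * poly (g t) x) ^ P)"
      unfolding T_def P_def p_def by (simp add: poly_sum frob_sum)
    also have "\<dots> = (\<Sum>t\<in>I. a t * poly (U t) x)"
      using a(1) by (intro sum.cong) (auto simp: power_mult_distrib gU[unfolded P_def p_def] P_def p_def GF_frob)
    also have "\<dots> = poly (\<Sum>t\<in>I. smult (a t) (U t)) x" by (simp add: poly_sum)
    finally show ?thesis by (simp add: a(3))
  qed
  have "card {x \<in> GF (2 * m). frob_trace (2 * m) (poly f x) = c} \<le> card {x. poly T x = 0}"
    using zero by (intro card_mono poly_roots_finite T0) auto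
  also have "\<dots> \<le> degree T" by (rule card_poly_roots_bound[OF T0])
  also note deg_T
  also have "P * R = p ^ (2 * m - 1)" unfolding P_def R_def power_add[symmetric] using m by (intro arg_cong[of _ _ "\<lambda>k. p ^ k"]) simp
  finally show ?thesis by (simp add: P_def p_def d_def)
qed

section \<open>Frobenius-stable multisets\<close>

text \<open>
These stand for the monic polynomials of degree \<open>n\<close> over the prime field, given by their roots;
\<open>bij_betw_linprod\<close> below makes this precise.
\<close>

definition frob_multisets :: "nat \<Rightarrow> 'a::field_prime_char multiset set" where
  "frob_multisets n = {M. size M = n \<and> image_mset (\<lambda>x. x ^ CHAR('a)) M = M}"

lemma coeff_linprod_frob:
  fixes A :: "'a::field_prime_char multiset"
  shows "coeff (linprod (image_mset (\<lambda>x. x ^ CHAR('a)) A)) i = coeff (linprod A) i ^ CHAR('a)"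
proof (induction A arbitrary: i)
  case empty
  show ?case by (auto simp: coeff_1 power_0_left)
next
  case (add x A)
  have "(u - v) ^ CHAR('a) = u ^ CHAR('a) - v ^ CHAR('a)" for u v :: 'a using frob_diff[of u v 1] by simp
  thus ?case using add.IH by (cases i) (auto simp: coeff_pCons power_mult_distrib minus_power_prime_CHAR)
qed

lemma frob_multisets_linprod:
  fixes M :: "'a::{alg_closed_field,field_prime_char} multiset"
  shows "image_mset (\<lambda>x. x ^ CHAR('a)) M = M \<longleftrightarrow> prime_coeffs (linprod M)"
proof -
  have "image_mset (\<lambda>x. x ^ CHAR('a)) M = M \<longleftrightarrow> linprod (image_mset (\<lambda>x. x ^ CHAR('a)) M) = linprod M"
    by (metis proots_linprod)
  also have "\<dots> \<longleftrightarrow> prime_coeffs (linprod M)"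
    by (auto simp: poly_eq_iff coeff_linprod_frob prime_coeffs_def GF_def)
  finally show ?thesis .
qed

lemma bij_betw_linprod:
  "bij_betw linprod (frob_multisets n :: 'a::{alg_closed_field,field_prime_char} multiset set)
     {Q. degree Q = n \<and> lead_coeff Q = 1 \<and> prime_coeffs Q}"
proof (rule bij_betw_byWitness[of _ proots])
  have "proots Q \<in> frob_multisets n" if "degree Q = n" "lead_coeff Q = 1" "prime_coeffs Q" for Q :: "'a poly"
    using linprod_proots[OF that(2)] degree_linprod[of "proots Q"] that
    unfolding frob_multisets_def by (auto simp: frob_multisets_linprod)
  thus "proots ` {Q :: 'a poly. degree Q = n \<and> lead_coeff Q = 1 \<and> prime_coeffs Q} \<subseteq> frob_multisets n" by blast
qed (auto simp: linprod_proots frob_multisets_def frob_multisets_linprod)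

lemma finite_frob_multisets:
  "finite (frob_multisets n :: 'a::{alg_closed_field,field_prime_char} multiset set)"
proof -
  let ?Q = "{Q :: 'a poly. degree Q = n \<and> lead_coeff Q = 1 \<and> prime_coeffs Q}"
  have "(\<lambda>Q. \<lambda>k\<in>{..n}. coeff Q k) ` ?Q \<subseteq> ({..n} \<rightarrow>\<^sub>E GF 1)"
    by (rule image_subsetI) (simp add: prime_coeffs_def)
  hence "finite ((\<lambda>Q. \<lambda>k\<in>{..n}. coeff Q k) ` ?Q)" 
    by (rule finite_subset) (auto intro!: finite_PiE finite_GF)
  moreover have "inj_on (\<lambda>Q. \<lambda>k\<in>{..n}. coeff Q k) ?Q"
  proof (intro inj_onI poly_eqI)
    fix Q Q' k assume "Q \<in> ?Q" "Q' \<in> ?Q" and eq: "(\<lambda>k\<in>{..n}. coeff Q k) = (\<lambda>k\<in>{..n}. coeff Q' k)"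
    have "coeff Q k = coeff Q' k" if "k \<le> n" using fun_cong[OF eq, of k] that by simp
    thus "coeff Q k = coeff Q' k" using \<open>Q \<in> ?Q\<close> \<open>Q' \<in> ?Q\<close> by (cases "k \<le> n") (auto simp: coeff_eq_0)
  qed
  ultimately have "finite ?Q" by (rule finite_imageD)
  thus ?thesis using bij_betw_finite[OF bij_betw_linprod[of n]] by blast
qed

text \<open>
For \<open>x \<in> GF k\<close> this is the multiset of roots of the characteristic polynomial of \<open>x\<close> over the prime
field: the conjugates of \<open>x\<close>, each repeated \<open>k / r\<close> times if \<open>x\<close> has \<open>r\<close> conjugates.
\<close>

definition frob_orbit :: "nat \<Rightarrow> 'a::field_prime_char \<Rightarrow> 'a multiset" where
  "frob_orbit k x = image_mset (\<lambda>i. x ^ (CHAR('a) ^ i)) (mset_set {..<k})"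

lemma size_frob_orbit [simp]: "size (frob_orbit k x) = k"
  by (simp add: frob_orbit_def)

lemma frob_orbit_stable:
  fixes x :: "'a::field_prime_char"
  assumes "x \<in> GF k"
  shows "frob_orbit k x \<in> frob_multisets k"
proof (cases k)
  case 0
  thus ?thesis by (simp add: frob_multisets_def frob_orbit_def)
next
  case (Suc r)
  have e: "(x ^ (CHAR('a) ^ i)) ^ CHAR('a) = x ^ (CHAR('a) ^ Suc i)" for i
    by (simp add: mult.commute flip: power_mult)
  have "image_mset (\<lambda>y. y ^ CHAR('a)) (frob_orbit k x) = image_mset (\<lambda>i. x ^ (CHAR('a) ^ i)) (image_mset Suc (mset_set {..<k}))"
    unfolding frob_orbit_def multiset.map_comp o_def e ..
  also have "image_mset Suc (mset_set {..<k}) = mset_set (insert k {1..<k})"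
  proof -
    have "Suc ` {..<k} = insert k {1..<k}" unfolding image_Suc_lessThan using Suc by auto
    thus ?thesis by (simp add: image_mset_mset_set)
  qed
  also have "image_mset (\<lambda>i. x ^ (CHAR('a) ^ i)) \<dots> = image_mset (\<lambda>i. x ^ (CHAR('a) ^ i)) (mset_set (insert 0 {1..<k}))"
    using assms by (simp add: GF_def)
  also have "insert 0 {1..<k} = {..<k}" using Suc by auto
  finally show ?thesis by (simp add: frob_multisets_def frob_orbit_def)
qed

lemma frob_orbit_mult:
  fixes x :: "'a::field_prime_char"
  assumes "x \<in> GF r"
  shows "frob_orbit (r * j) x = repeat_mset j (frob_orbit r x)"
proof (induction j)
  case 0
  show ?case by (simp add: frob_orbit_def)
next
  case (Suc j)
  have "{..<r * Suc j} = {..<r * j} \<union> (\<lambda>i. r * j + i) ` {..<r}"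
  proof (intro equalityI subsetI)
    fix i assume "i \<in> {..<r * Suc j}"
    thus "i \<in> {..<r * j} \<union> (\<lambda>i. r * j + i) ` {..<r}"
      by (cases "i < r * j") (auto intro!: image_eqI[of _ _ "i - r * j"])
  qed auto
  hence "mset_set {..<r * Suc j} = mset_set {..<r * j} + image_mset (\<lambda>i. r * j + i) (mset_set {..<r})"
    by (simp add: image_mset_mset_set) (subst mset_set_Union, auto)
  moreover have "x ^ (CHAR('a) ^ (r * j + i)) = x ^ (CHAR('a) ^ i)" for i
  proof -
    have "x \<in> GF (r * j)" using GF_dvd[OF assms] by simp
    thus ?thesis using frob_frob[of x "r * j" i] by (simp add: GF_def)
  qed
  ultimately have "frob_orbit (r * Suc j) x = frob_orbit (r * j) x + frob_orbit r x"
    by (simp add: frob_orbit_def multiset.map_comp o_def)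
  thus ?case using Suc.IH by (simp add: add.commute)
qed

text \<open>
If \<open>x\<close> has \<open>r\<close> conjugates, then \<open>x \<in> GF k\<close> exactly for the multiples \<open>k = r j\<close>, and the orbit of
length \<open>r j\<close> is \<open>j\<close> copies of the set of conjugates. All conjugates have the same multiplicity in the
stable multiset \<open>M\<close>, so \<open>j\<close> may be any number from 1 to the multiplicity of \<open>x\<close>. Counting in this way
replaces unique factorisation into irreducible polynomials, that is, the Euler product.
\<close>

lemma card_frob_orbits_below:
  fixes M :: "'a::field_prime_char multiset"
  assumes M: "M \<in> frob_multisets n" and x: "x \<in># M"
  shows "card {k \<in> {1..n}. x \<in> GF k \<and> frob_orbit k x \<subseteq># M} = count M x"
proof -
  let ?F = "\<lambda>i. x ^ (CHAR('a) ^ i)"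
  have inj: "inj (\<lambda>y::'a. y ^ CHAR('a))" using frob_inj[of _ 1] by (auto intro!: injI)
  have cnt: "count M (y ^ CHAR('a)) = count M y" for y
  proof -
    have "count (image_mset (\<lambda>y. y ^ CHAR('a)) M) (y ^ CHAR('a)) = count M y"
      by (induction M) (use inj in \<open>auto dest: injD\<close>)
    thus ?thesis using M by (simp add: frob_multisets_def)
  qed
  have cF: "count M (?F i) = count M x" for i
  proof (induction i)
    case (Suc i)
    thus ?case using cnt[of "?F i"] by (simp add: mult.commute flip: power_mult)
  qed auto
  have "range ?F \<subseteq> set_mset M" using cF x by (auto simp flip: count_greater_zero_iff)
  hence "\<not> inj ?F" using finite_subset[OF _ finite_set_mset] range_inj_infinite by blast
  then obtain i j where ij: "i < j" "?F i = ?F j" unfolding inj_def by (metis linorder_neqE_nat)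
  define s where "s = j - i"
  have s: "s > 0" using ij by (simp add: s_def)
  have sG: "x \<in> GF s"
  proof -
    have "(?F s) ^ (CHAR('a) ^ i) = ?F i" using ij unfolding frob_frob s_def by simp
    thus ?thesis by (simp add: frob_inj GF_def)
  qed
  define r where "r = (LEAST r. r > 0 \<and> x \<in> GF r)"
  have r: "r > 0" "x \<in> GF r" and rmin: "\<And>k. k > 0 \<Longrightarrow> x \<in> GF k \<Longrightarrow> r \<le> k"
    unfolding r_def using LeastI[of "\<lambda>r. r > 0 \<and> x \<in> GF r" s] Least_le[of "\<lambda>r. r > 0 \<and> x \<in> GF r"] s sG by auto
  have GFk: "x \<in> GF k \<longleftrightarrow> r dvd k" for k
  proof
    assume k: "x \<in> GF k"
    have "x \<in> GF (r * (k div r))" using GF_dvd[OF r(2)] by simp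
    hence "?F k = ?F (k mod r)" using frob_frob[of x "r * (k div r)" "k mod r"] by (simp add: GF_def)
    hence "x \<in> GF (k mod r)" using k by (simp add: GF_def)
    moreover have "k mod r < r" using r by simp
    ultimately show "r dvd k" using rmin[of "k mod r"] by (cases "k mod r = 0") auto
  qed (use GF_dvd r in blast)
  have injF: "inj_on ?F {..<r}"
  proof (rule linorder_inj_onI)
    fix a b assume ab: "a < b" "a \<in> {..<r}" "b \<in> {..<r}"
    show "?F a \<noteq> ?F b"
    proof
      assume eq: "?F a = ?F b"
      have "(?F (b - a)) ^ (CHAR('a) ^ a) = ?F a" using ab eq unfolding frob_frob by simp
      hence "x \<in> GF (b - a)" by (simp add: frob_inj GF_def)
      thus False using rmin[of "b - a"] ab by auto
    qed
  qed auto
  have orb: "frob_orbit r x = mset_set (?F ` {..<r})" using injF by (simp add: frob_orbit_def image_mset_mset_set)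
  have sub: "frob_orbit (r * j) x \<subseteq># M \<longleftrightarrow> j \<le> count M x" for j
  proof
    assume "frob_orbit (r * j) x \<subseteq># M"
    hence "count (frob_orbit (r * j) x) x \<le> count M x" by (simp add: mset_subset_eq_count)
    moreover have "x \<in> ?F ` {..<r}" using r by (intro image_eqI[of _ _ 0]) auto
    ultimately show "j \<le> count M x" by (simp add: frob_orbit_mult[OF r(2)] orb)
  next
    assume j: "j \<le> count M x"
    show "frob_orbit (r * j) x \<subseteq># M"
      unfolding frob_orbit_mult[OF r(2)] orb
    proof (rule mset_subset_eqI)
      fix y show "count (repeat_mset j (mset_set (?F ` {..<r}))) y \<le> count M y"
        using j cF by (cases "y \<in> ?F ` {..<r}") auto
    qed
  qed
  have "{k \<in> {1..n}. x \<in> GF k \<and> frob_orbit k x \<subseteq># M} = (\<lambda>j. r * j) ` {1..count M x}"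
  proof (intro equalityI subsetI)
    fix k assume k: "k \<in> {k \<in> {1..n}. x \<in> GF k \<and> frob_orbit k x \<subseteq># M}"
    then obtain j where "k = r * j" using GFk by (auto elim: dvdE)
    with k sub show "k \<in> (\<lambda>j. r * j) ` {1..count M x}" by (intro image_eqI[of _ _ j]) (auto simp: Suc_le_eq One_nat_def)
  next
    fix k assume "k \<in> (\<lambda>j. r * j) ` {1..count M x}"
    then obtain j where "k = r * j" "j \<in> {1..count M x}" by (elim imageE)
    hence j: "k = r * j" "1 \<le> j" "j \<le> count M x" by simp_all
    have "frob_orbit k x \<subseteq># M" using sub j by simp
    hence "k \<le> n" using size_mset_mono[of "frob_orbit k x" M] M by (simp add: frob_multisets_def)
    thus "k \<in> {k \<in> {1..n}. x \<in> GF k \<and> frob_orbit k x \<subseteq># M}"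
      using j sub GFk r by (auto simp: Suc_le_eq One_nat_def)
  qed
  also have "card \<dots> = count M x" using r by (subst card_image) (auto intro!: inj_onI)
  finally show ?thesis .
qed

section \<open>The L-function and the Weil bound\<close>

lemma frob_sum_mset: "(\<Sum>x\<in>#M. g x) ^ CHAR('a) = (\<Sum>x\<in>#M. g x ^ CHAR('a))"
  for g :: "'b \<Rightarrow> 'a::field_prime_char"
  by (induction M) (auto simp: power_0_left freshmans_dream)

text \<open>
Only the restriction of \<open>e\<close> to the prime field \<open>GF 1\<close> matters: it is a nontrivial additive character.
\<close>

locale weil_sum =
  fixes e :: "'a::{alg_closed_field,field_prime_char} \<Rightarrow> complex" and f :: "'a poly"
  assumes e_add: "x \<in> GF 1 \<Longrightarrow> y \<in> GF 1 \<Longrightarrow> e (x + y) = e x * e y"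
    and e_norm: "x \<in> GF 1 \<Longrightarrow> cmod (e x) = 1"
    and e_1: "e 1 \<noteq> 1"
    and f: "prime_coeffs f" and deg_f: "\<not> CHAR('a) dvd degree f"
begin

definition S :: "nat \<Rightarrow> complex" where
  "S n = (\<Sum>x\<in>GF n. e (frob_trace n (poly f x)))"

definition L_char :: "'a multiset \<Rightarrow> complex" where
  "L_char M = e (\<Sum>x\<in>#M. poly f x)"

text \<open>
The coefficients of the L-function attached to \<open>e\<close> and \<open>f\<close>; \<open>L_char\<close> is multiplicative in the monic
polynomial whose roots are \<open>M\<close>.
\<close>

definition L_coeff :: "nat \<Rightarrow> complex" where
  "L_coeff n = (\<Sum>M\<in>frob_multisets n. L_char M)"

lemma e_0: "e 0 = 1"
proof -
  have "e 0 * e 0 = e 0 * 1" using e_add[of 0 0] by simp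
  moreover have "e 0 \<noteq> 0" using e_norm[of 0] by auto
  ultimately show ?thesis by (metis mult_left_cancel)
qed

lemma sum_e: "(\<Sum>c\<in>GF 1. e c) = 0"
proof -
  have "(\<Sum>c\<in>GF 1. e c) = (\<Sum>c\<in>GF 1. e (c + 1))"
    by (rule sum.reindex_bij_witness[of _ "\<lambda>c. c + 1" "\<lambda>c. c - 1"]) auto
  also have "\<dots> = (\<Sum>c\<in>GF 1. e c) * e 1" by (simp add: e_add sum_distrib_right)
  finally show ?thesis using e_1 by simp
qed

text \<open>
The deviations of the fibre sizes from their mean \<open>q\<close> add up to zero and are bounded above
by \<open>B\<close>, so their absolute values add up to at most \<open>2 B\<close> times the number of fibres. The main
term \<open>q\<close> disappears because \<open>e\<close> sums to zero over the prime field.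
\<close>

lemma S_even_bound:
  assumes m: "m > 0"
  shows "cmod (S (2 * m)) \<le> (2 * CHAR('a) * (3 * degree f + 1)) * real CHAR('a) ^ m"
proof -
  define q :: real where "q = CHAR('a) ^ (2 * m - 1)"
  define B :: real where "B = (3 * degree f + 1) * CHAR('a) ^ m"
  define N where "N = (\<lambda>c. {x \<in> GF (2 * m). frob_trace (2 * m) (poly f x) = c})"
  define u where "u = (\<lambda>c. real (card (N c)) - q)"
  have fin: "finite (GF (2 * m) :: 'a set)" "finite (GF 1 :: 'a set)" using m by (auto intro: finite_GF)
  have card1: "card (GF 1 :: 'a set) = CHAR('a)" by (simp add: card_GF)
  have tr: "frob_trace (2 * m) (poly f x) \<in> GF 1" if "x \<in> GF (2 * m)" for x
    using frob_trace_GF[OF prime_coeffs_poly[OF f that]] m by simp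
  have "S (2 * m) = (\<Sum>c\<in>GF 1. \<Sum>x\<in>N c. e (frob_trace (2 * m) (poly f x)))"
    unfolding S_def N_def by (rule sum.group[symmetric]) (use fin tr in auto)
  also have "\<dots> = (\<Sum>c\<in>GF 1. of_nat (card (N c)) * e c)"
    by (rule sum.cong) (auto simp: N_def)
  also have "\<dots> = (\<Sum>c\<in>GF 1. of_real (u c) * e c) + of_real q * (\<Sum>c\<in>GF 1. e c)"
    by (simp add: u_def algebra_simps sum.distrib sum_distrib_left sum_subtractf)
  finally have S: "S (2 * m) = (\<Sum>c\<in>GF 1. of_real (u c) * e c)" by (simp add: sum_e)
  have uB: "u c \<le> B" if "c \<in> GF 1" for c
  proof -
    have "card (N c) \<le> CHAR('a) ^ (2 * m - 1) + (3 * degree f + 1) * CHAR('a) ^ m"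
      unfolding N_def by (rule trace_fibre_bound[OF f deg_f m that])
    hence "real (card (N c)) \<le> real (CHAR('a) ^ (2 * m - 1) + (3 * degree f + 1) * CHAR('a) ^ m)"
      by (rule of_nat_mono)
    thus ?thesis by (simp add: u_def q_def B_def)
  qed
  have "(\<Sum>c\<in>GF 1. card (N c)) = card (GF (2 * m) :: 'a set)"
    unfolding N_def card_eq_sum by (rule sum.group) (use fin tr in auto)
  also have "\<dots> = CHAR('a) ^ (2 * m)" using m by (simp add: card_GF)
  finally have "(\<Sum>c\<in>GF 1. real (card (N c))) = real (CHAR('a) ^ (2 * m))" by (metis of_nat_sum)
  also have "CHAR('a) ^ (2 * m) = CHAR('a) * CHAR('a) ^ (2 * m - 1)"
    using m by (simp flip: power_Suc)
  finally have u0: "(\<Sum>c\<in>GF 1. u c) = 0" by (simp add: u_def sum_subtractf card1 q_def)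
  have "cmod (S (2 * m)) \<le> (\<Sum>c\<in>GF 1. cmod (of_real (u c) * e c))" unfolding S by (rule norm_sum)
  also have "\<dots> = (\<Sum>c\<in>GF 1. \<bar>u c\<bar>)" by (simp add: norm_mult e_norm)
  also have "\<dots> \<le> (\<Sum>c\<in>GF 1. 2 * B - u c)"
  proof (rule sum_mono)
    fix c :: 'a assume "c \<in> GF 1"
    moreover have "B \<ge> 0" by (simp add: B_def)
    ultimately show "\<bar>u c\<bar> \<le> 2 * B - u c" using uB[of c] by linarith
  qed
  also have "\<dots> = 2 * CHAR('a) * B" by (simp add: sum_subtractf u0 card1)
  finally show ?thesis by (simp add: B_def mult.assoc)
qed

lemma sum_poly_GF:
  assumes "M \<in> frob_multisets n"
  shows "(\<Sum>x\<in>#M. poly f x) \<in> GF 1"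
proof -
  have "(\<Sum>x\<in>#M. poly f x) ^ CHAR('a) = (\<Sum>x\<in>#M. poly f (x ^ CHAR('a)))"
    using prime_coeffs_frob[OF f, of _ 1] by (simp add: frob_sum_mset)
  also have "\<dots> = (\<Sum>x\<in>#image_mset (\<lambda>x. x ^ CHAR('a)) M. poly f x)" by (simp add: multiset.map_comp o_def)
  also have "image_mset (\<lambda>x. x ^ CHAR('a)) M = M" using assms by (simp add: frob_multisets_def)
  finally show ?thesis by (simp add: GF_def)
qed

lemma L_char_add:
  "M \<in> frob_multisets m \<Longrightarrow> N \<in> frob_multisets n \<Longrightarrow> L_char (M + N) = L_char M * L_char N"
  by (simp add: L_char_def e_add[OF sum_poly_GF sum_poly_GF])

lemma L_char_orbit: "L_char (frob_orbit k x) = e (frob_trace k (poly f x))"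
  by (simp add: L_char_def frob_orbit_def frob_trace_def multiset.map_comp o_def
      prime_coeffs_frob[OF f] flip: sum_unfold_sum_mset)

lemma sum_L_char_above_orbit:
  assumes x: "x \<in> GF k" and k: "k \<le> n"
  shows "(\<Sum>M\<in>{M \<in> frob_multisets n. frob_orbit k x \<subseteq># M}. L_char M)
    = L_char (frob_orbit k x) * L_coeff (n - k)"
proof -
  have stab: "frob_orbit k x \<in> frob_multisets k" using x by (rule frob_orbit_stable)
  have "(\<Sum>M\<in>{M \<in> frob_multisets n. frob_orbit k x \<subseteq># M}. L_char M)
      = (\<Sum>N\<in>frob_multisets (n - k). L_char (frob_orbit k x + N))"
    by (rule sum.reindex_bij_witness[of _ "\<lambda>N. frob_orbit k x + N" "\<lambda>M. M - frob_orbit k x"])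
       (use stab k in \<open>auto simp: frob_multisets_def image_mset_Diff size_Diff_submset\<close>)
  also have "\<dots> = L_char (frob_orbit k x) * L_coeff (n - k)"
    unfolding L_coeff_def sum_distrib_left by (rule sum.cong) (auto simp: L_char_add[OF stab])
  finally show ?thesis .
qed

text \<open>
Every stable multiset \<open>M\<close> of size \<open>n\<close> contains exactly \<open>n\<close> orbits \<open>frob_orbit k x\<close>, counted over the
pairs \<open>(k, x)\<close> with \<open>1 \<le> k \<le> n\<close> and \<open>x \<in> GF k\<close>. Splitting one orbit off \<open>M\<close> leaves an arbitrary
stable multiset of size \<open>n - k\<close>, and the character value of the orbit is the term of \<open>x\<close> in \<open>S k\<close>.
\<close>

lemma L_coeff_rec: "of_nat n * L_coeff n = (\<Sum>k=1..n. S k * L_coeff (n - k))"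
proof -
  have size: "n = (\<Sum>k=1..n. card {x \<in> GF k. frob_orbit k x \<subseteq># M})" if M: "M \<in> frob_multisets n" for M :: "'a multiset"
  proof -
    have "n = (\<Sum>x\<in>set_mset M. count M x)"
      using M by (simp add: frob_multisets_def size_multiset_overloaded_eq)
    also have "\<dots> = (\<Sum>x\<in>set_mset M. \<Sum>k=1..n. of_bool (x \<in> GF k \<and> frob_orbit k x \<subseteq># M))"
      by (rule sum.cong) (auto simp: card_frob_orbits_below[OF M, symmetric] Int_def)
    also have "\<dots> = (\<Sum>k=1..n. \<Sum>x\<in>set_mset M. of_bool (x \<in> GF k \<and> frob_orbit k x \<subseteq># M))"
      by (rule sum.swap)
    also have "\<dots> = (\<Sum>k=1..n. card {x \<in> GF k. frob_orbit k x \<subseteq># M})"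
    proof (rule sum.cong)
      fix k assume k: "k \<in> {1..n}"
      have "x \<in># M" if "frob_orbit k x \<subseteq># M" for x :: 'a
      proof -
        have "x \<in># frob_orbit k x" using k by (auto simp: frob_orbit_def intro!: image_eqI[of _ _ 0])
        thus ?thesis using that by (rule mset_subset_eqD[rotated])
      qed
      hence "set_mset M \<inter> {x. x \<in> GF k \<and> frob_orbit k x \<subseteq># M} = {x \<in> GF k. frob_orbit k x \<subseteq># M}" by auto
      thus "(\<Sum>x\<in>set_mset M. of_bool (x \<in> GF k \<and> frob_orbit k x \<subseteq># M)) = card {x \<in> GF k. frob_orbit k x \<subseteq># M}"
        by simp
    qed auto
    finally show ?thesis .
  qed
  have "of_nat n * L_coeff n = (\<Sum>M\<in>frob_multisets n. of_nat n * L_char M)"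
    by (simp add: L_coeff_def sum_distrib_left)
  also have "\<dots> = (\<Sum>M\<in>frob_multisets n. \<Sum>k=1..n. \<Sum>x\<in>GF k. of_bool (frob_orbit k x \<subseteq># M) * L_char M)"
  proof (rule sum.cong)
    fix M :: "'a multiset" assume M: "M \<in> frob_multisets n"
    have "(of_nat n :: complex) = (\<Sum>k=1..n. of_nat (card {x \<in> GF k. frob_orbit k x \<subseteq># M}))"
      using arg_cong[OF size[OF M], of "of_nat :: nat \<Rightarrow> complex"] by simp
    also have "\<dots> = (\<Sum>k=1..n. \<Sum>x\<in>GF k. of_bool (frob_orbit k x \<subseteq># M))"
      by (rule sum.cong) (auto simp: finite_GF Int_def)
    finally show "of_nat n * L_char M = (\<Sum>k=1..n. \<Sum>x\<in>GF k. of_bool (frob_orbit k x \<subseteq># M) * L_char M)"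
      by (simp only: sum_distrib_right)
  qed auto
  also have "\<dots> = (\<Sum>k=1..n. \<Sum>x\<in>GF k. \<Sum>M\<in>frob_multisets n. of_bool (frob_orbit k x \<subseteq># M) * L_char M)"
    by (subst sum.swap, rule sum.cong[OF refl], rule sum.swap)
  also have "\<dots> = (\<Sum>k=1..n. \<Sum>x\<in>GF k. e (frob_trace k (poly f x)) * L_coeff (n - k))"
  proof (intro sum.cong refl)
    fix k and x :: 'a assume k: "k \<in> {1..n}" and x: "x \<in> GF k"
    have "(\<Sum>M\<in>frob_multisets n. of_bool (frob_orbit k x \<subseteq># M) * L_char M)
       = (\<Sum>M\<in>{M \<in> frob_multisets n. frob_orbit k x \<subseteq># M}. L_char M)"
      by (rule sum.mono_neutral_cong_right) (auto simp: finite_frob_multisets)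
    also have "\<dots> = e (frob_trace k (poly f x)) * L_coeff (n - k)"
      using sum_L_char_above_orbit[OF x, of n] k by (simp add: L_char_orbit)
    finally show "(\<Sum>M\<in>frob_multisets n. of_bool (frob_orbit k x \<subseteq># M) * L_char M)
       = e (frob_trace k (poly f x)) * L_coeff (n - k)" .
  qed
  finally show ?thesis by (simp add: S_def sum_distrib_right)
qed

lemma deg_f_pos: "degree f > 0"
  using deg_f by (cases "degree f") auto

lemma L_coeff_0: "L_coeff 0 = 1"
proof -
  have "frob_multisets 0 = {{#} :: 'a multiset}" by (auto simp: frob_multisets_def)
  thus ?thesis by (simp add: L_coeff_def L_char_def e_0)
qed

text \<open>
Adding a constant \<open>t\<close> to the coefficient of \<open>X^(n - d)\<close> permutes the monic polynomials of degree \<open>n\<close>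
over the prime field. It lowers the \<open>d\<close>-th power sum of the roots by \<open>d t\<close> and fixes the earlier ones,
so it changes the sum of \<open>f\<close> over the roots by a constant. For the \<open>t\<close> chosen here this constant is 1,
and the sum is multiplied by \<open>e 1 \<noteq> 1\<close> without changing.
\<close>

lemma L_coeff_eq_0:
  assumes n: "n \<ge> degree f"
  shows "L_coeff n = 0"
proof -
  define d a where "d = degree f" and "a = lead_coeff f"
  have d: "0 < d" "d \<le> n" using deg_f_pos n by (auto simp: d_def)
  have a: "a \<noteq> 0" "a \<in> GF 1" using deg_f_pos f by (auto simp: a_def prime_coeffs_def)
  have d0: "(of_nat d :: 'a) \<noteq> 0" using deg_f by (simp add: d_def of_nat_eq_0_iff_char_dvd)
  define t where "t = - inverse (of_nat d * a)"
  have t: "t \<in> GF 1" using a unfolding t_def by (intro GF_uminus GF_inverse GF_mult GF_of_nat)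
  define \<Phi> where "\<Phi> = (\<lambda>t (M::'a multiset). proots (linprod M + monom t (n - d)))"
  have \<Phi>: "\<Phi> t M \<in> frob_multisets n" "linprod (\<Phi> t M) = linprod M + monom t (n - d)"
    if t: "t \<in> GF 1" and M: "M \<in> frob_multisets n" for t M
  proof -
    let ?Q = "linprod M + monom t (n - d)"
    have sz: "size M = n" and pc: "prime_coeffs (linprod M)" 
      using M by (auto simp: frob_multisets_def frob_multisets_linprod)
    have deg: "degree ?Q = n"
      using d degree_monom_le[of t "n - d"] sz by (subst degree_add_eq_left) (auto simp: le_less_trans)
    have "lead_coeff ?Q = 1" using d coeff_linprod_size[of M] unfolding deg by (simp add: sz)
    thus lin: "linprod (\<Phi> t M) = ?Q" unfolding \<Phi>_def by (rule linprod_proots)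
    have "prime_coeffs ?Q" using pc t by (auto intro: prime_coeffs_intros)
    moreover have "size (\<Phi> t M) = n" using degree_linprod[of "\<Phi> t M"] by (simp add: lin deg)
    ultimately show "\<Phi> t M \<in> frob_multisets n"
      unfolding frob_multisets_def by (simp add: frob_multisets_linprod lin)
  qed
  have inv: "\<Phi> (- t) (\<Phi> t M) = M" if "t \<in> GF 1" "M \<in> frob_multisets n" for t M
    using \<Phi>(2)[OF that] unfolding \<Phi>_def by (simp flip: minus_monom)
  have "L_coeff n = (\<Sum>M\<in>frob_multisets n. L_char (\<Phi> t M))"
    unfolding L_coeff_def
    by (rule sum.reindex_bij_witness[of _ "\<Phi> t" "\<Phi> (- t)"])
       (use \<Phi>(1) inv[OF t] inv[OF GF_uminus[OF t]] t GF_uminus[OF t] in auto)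
  also have "\<dots> = (\<Sum>M\<in>frob_multisets n. L_char M * e 1)"
  proof (rule sum.cong)
    fix M :: "'a multiset" assume M: "M \<in> frob_multisets n"
    have sz: "size M = n" "size (\<Phi> t M) = n" using M \<Phi>(1)[OF t M] by (auto simp: frob_multisets_def)
    note shift = power_sum_shift[OF sz \<Phi>(2)[OF t M] d]
    have "power_sum (\<Phi> t M) j = power_sum M j" if "j < d" for j
      using shift(1)[of j] that sz by (cases "j = 0") (auto simp: power_sum_def)
    hence "(\<Sum>j<d. coeff f j * power_sum (\<Phi> t M) j) = (\<Sum>j<d. coeff f j * power_sum M j)" by simp
    moreover have "{..d} = insert d {..<d}" by auto
    ultimately have "(\<Sum>x\<in>#\<Phi> t M. poly f x) = (\<Sum>x\<in>#M. poly f x) - a * (of_nat d * t)"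
      unfolding sum_mset_poly a_def d_def[symmetric]
      by (simp only: sum.insert finite_lessThan lessThan_iff less_irrefl not_False_eq_True shift(2)
          right_diff_distrib add_diff_eq diff_add_eq)
    also have "\<dots> = (\<Sum>x\<in>#M. poly f x) + 1" using a d0 by (simp add: t_def field_simps)
    finally show "L_char (\<Phi> t M) = L_char M * e 1"
      using sum_poly_GF[OF M] by (simp add: L_char_def e_add)
  qed auto
  also have "\<dots> = L_coeff n * e 1" by (simp add: L_coeff_def sum_distrib_right)
  finally show ?thesis using e_1 by simp
qed

text \<open>
\<open>S_even_bound\<close> speaks about even exponents only, so \<open>power_sum_bound\<close> is applied to the squares of
the reciprocal zeros of the L-function.
\<close>

theorem weil_bound: "cmod (S 1) \<le> (degree f - 1) * sqrt CHAR('a)"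
proof -
  obtain A where A: "size A = degree f - 1" "\<And>k. k > 0 \<Longrightarrow> S k = - power_sum A k"
    using newton_inverse[of "degree f" L_coeff S] deg_f_pos L_coeff_0 L_coeff_eq_0 L_coeff_rec by blast
  have le: "cmod w \<le> sqrt CHAR('a)" if w: "w \<in># A" for w
  proof -
    have "cmod (w ^ 2) \<le> CHAR('a)"
    proof (rule power_sum_bound)
      show "w ^ 2 \<in># image_mset (\<lambda>w. w ^ 2) A" using w by simp
      show "cmod (\<Sum>z\<in>#image_mset (\<lambda>w. w ^ 2) A. z ^ m)
          \<le> (2 * CHAR('a) * (3 * degree f + 1)) * real CHAR('a) ^ m" if "m \<ge> 1" for m
        using S_even_bound[of m] A(2)[of "2 * m"] that
        by (simp add: power_sum_def multiset.map_comp o_def flip: power_mult)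
    qed (simp)
    thus ?thesis by (simp add: norm_power real_le_rsqrt)
  qed
  have "cmod (S 1) = cmod (\<Sum>w\<in>#A. w)" by (simp add: A(2) power_sum_def)
  also have "\<dots> \<le> (\<Sum>w\<in>#A. cmod w)" by (induction A) (auto intro: norm_triangle_le)
  also have "\<dots> \<le> (\<Sum>w\<in>#A. sqrt CHAR('a))" by (rule sum_mset_mono) (use le in auto)
  finally show ?thesis using A(1) by simp
qed

end

section \<open>The exponential of an integer modulo p\<close>

lemma \<psi>_cis: "\<psi> p a = cis (2 * pi * a / p)"
  by (simp add: \<psi>_def cis_conv_exp mult_ac)

lemma \<psi>_0 [simp]: "\<psi> p 0 = 1"
  by (simp add: \<psi>_def)

lemma \<psi>_add: "\<psi> p (a + b) = \<psi> p a * \<psi> p b"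
  by (simp add: \<psi>_def exp_add[symmetric] algebra_simps add_divide_distrib)

lemma norm_\<psi> [simp]: "cmod (\<psi> p a) = 1"
  by (simp add: \<psi>_cis)

lemma \<psi>_eq_1_iff:
  assumes p: "p > 0"
  shows "\<psi> p a = 1 \<longleftrightarrow> int p dvd a"
proof
  assume "\<psi> p a = 1"
  hence "cos (2 * pi * a / p) = 1" by (simp add: \<psi>_cis complex_eq_iff)
  then obtain n :: int where "2 * pi * a / p = of_int n * 2 * pi" unfolding cos_one_2pi_int by blast
  hence "real_of_int a = real p * n" using p by (simp add: field_simps)
  hence "a = int p * n" by (metis of_int_eq_iff of_int_mult of_int_of_nat_eq)
  thus "int p dvd a" by simp
next
  assume "int p dvd a"
  then obtain n where n: "a = int p * n" by (elim dvdE)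
  have "2 * pi * a / p = 2 * pi * n" using p by (simp add: n)
  thus "\<psi> p a = 1" by (simp add: \<psi>_cis cis_multiple_2pi)
qed

lemma \<psi>_cong:
  assumes "p > 0" "[a = b] (mod int p)"
  shows "\<psi> p a = \<psi> p b"
proof -
  have "int p dvd a - b" using assms by (simp add: cong_iff_dvd_diff)
  hence "\<psi> p ((a - b) + b) = \<psi> p b" unfolding \<psi>_add using \<psi>_eq_1_iff[OF assms(1)] by simp
  thus ?thesis by simp
qed

lemma \<psi>_mod [simp]: "p > 0 \<Longrightarrow> \<psi> p (a mod int p) = \<psi> p a"
  by (rule \<psi>_cong) auto

lemma sum_\<psi>:
  assumes "p > 0"
  shows "(\<Sum>s\<in>{0..int p - 1}. \<psi> p (s * z)) = (if int p dvd z then of_nat p else 0)"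
proof -
  have pow: "\<psi> p (int k * z) = \<psi> p z ^ k" for k
    by (induction k) (auto simp: \<psi>_add algebra_simps)
  have "(\<Sum>s\<in>{0..int p - 1}. \<psi> p (s * z)) = (\<Sum>k<p. \<psi> p z ^ k)"
    unfolding pow[symmetric] by (rule sum.reindex_bij_witness[of _ int nat]) auto
  also have "\<dots> = (if int p dvd z then of_nat p else 0)"
  proof (cases "int p dvd z")
    case True
    hence "\<psi> p z = 1" using \<psi>_eq_1_iff[OF assms] by simp
    thus ?thesis using True by simp
  next
    case False
    hence "\<psi> p z \<noteq> 1" using \<psi>_eq_1_iff[OF assms] by simp
    moreover have "\<psi> p z ^ p = 1" unfolding pow[symmetric] using \<psi>_eq_1_iff[OF assms] by simp
    ultimately show ?thesis using False by (simp add: geometric_sum)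
  qed
  finally show ?thesis .
qed

section \<open>From one field to all primes\<close>

instance alg_closure :: (field_prime_char) field_prime_char
  by (rule field_prime_charI') simp

definition weil_bound_at :: "nat \<Rightarrow> bool" where
  "weil_bound_at p \<longleftrightarrow> (\<forall>g :: int poly. \<not> int p dvd lead_coeff g \<longrightarrow> \<not> p dvd degree g \<longrightarrow>
     cmod (\<Sum>k<p. \<psi> p (poly g (int k))) \<le> (degree g - 1) * sqrt p)"

text \<open>
The prime field consists of the images of the integers, which carries \<open>\<psi> p\<close> over to it.
\<close>

lemma weil_bound_at_CHAR:
  fixes ty :: "'a::{alg_closed_field,field_prime_char} itself"
  shows "weil_bound_at CHAR('a)"
  unfolding weil_bound_at_def
proof (intro allI impI)
  fix g :: "int poly"
  assume lc: "\<not> int CHAR('a) dvd lead_coeff g" and deg: "\<not> CHAR('a) dvd degree g"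
  define p where "p = CHAR('a)"
  have p: "p > 1" "p > 0" unfolding p_def using prime_gt_1_nat[OF CHAR_prime[where ?'a='a]] by auto
  define f where "f = (map_poly of_int g :: 'a poly)"
  have cf: "coeff f i = of_int (coeff g i)" for i by (simp add: f_def coeff_map_poly)
  have df: "degree f = degree g"
  proof (rule antisym[OF _ le_degree])
    show "degree f \<le> degree g" unfolding f_def by (rule degree_map_poly_le)
    show "coeff f (degree g) \<noteq> 0" using lc by (simp add: cf of_int_eq_0_iff_char_dvd)
  qed
  have pf: "poly f (of_nat k) = of_int (poly g (int k))" for k
    unfolding poly_altdef df cf by simp
  define e where "e = (\<lambda>x::'a. \<psi> p (int (inv_into {..<p} of_nat x)))"
  have GF1: "(GF 1 :: 'a set) = of_nat ` {..<p}" unfolding p_def by (rule GF_1_eq)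
  have e_int: "e (of_int a) = \<psi> p a" for a
  proof -
    have "(of_int a :: 'a) \<in> of_nat ` {..<p}" unfolding GF1[symmetric] by simp
    hence "of_nat (inv_into {..<p} of_nat (of_int a :: 'a)) = (of_int a :: 'a)" by (rule f_inv_into_f)
    hence "(of_int (int (inv_into {..<p} of_nat (of_int a :: 'a))) :: 'a) = of_int a" by simp
    hence "[int (inv_into {..<p} of_nat (of_int a :: 'a)) = a] (mod int p)"
      unfolding of_int_eq_iff_cong_CHAR p_def .
    thus ?thesis unfolding e_def by (rule \<psi>_cong[OF p(2)])
  qed
  have intE: "\<exists>a. x = of_int a" if "x \<in> GF 1" for x :: 'a
    using that unfolding GF1 by (metis imageE of_int_of_nat_eq)
  interpret weil_sum e f
  proof
    show "e (x + y) = e x * e y" if "x \<in> GF 1" "y \<in> GF 1" for x y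
      using intE[OF that(1)] intE[OF that(2)] by (auto simp: e_int \<psi>_add simp flip: of_int_add)
    show "cmod (e x) = 1" if "x \<in> GF 1" for x by (simp add: e_def)
    have "\<psi> p 1 \<noteq> 1" using p by (simp add: \<psi>_eq_1_iff)
    thus "e 1 \<noteq> 1" using e_int[of 1] by simp
  qed (use deg in \<open>auto simp: prime_coeffs_def cf df\<close>)
  have inj: "inj_on (of_nat :: nat \<Rightarrow> 'a) {..<p}"
    by (rule inj_onI) (auto simp: of_nat_eq_iff_cong_CHAR cong_def p_def)
  have "S 1 = (\<Sum>k<p. e (poly f (of_nat k)))"
    by (simp add: S_def GF1 sum.reindex[OF inj])
  also have "\<dots> = (\<Sum>k<p. \<psi> p (poly g (int k)))" by (simp add: pf e_int)
  finally show "cmod (\<Sum>k<CHAR('a). \<psi> CHAR('a) (poly g (int k))) \<le> (degree g - 1) * sqrt CHAR('a)"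
    using weil_bound by (simp add: p_def df)
qed

text \<open>
A type cannot depend on a variable prime. One type suffices nevertheless: take a prime at which the
bound fails if there is such a prime, and any prime otherwise. The bound at this single prime, which
follows from the existence of an algebraically closed field of that characteristic, implies it at
every prime.
\<close>

definition test_prime :: nat where
  "test_prime = (SOME p. prime p \<and> ((\<exists>q. prime q \<and> \<not> weil_bound_at q) \<longrightarrow> \<not> weil_bound_at p))"

lemma test_prime:
  "prime test_prime" "prime q \<Longrightarrow> \<not> weil_bound_at q \<Longrightarrow> \<not> weil_bound_at test_prime"
proof -
  have "\<exists>p. prime p \<and> ((\<exists>q. prime q \<and> \<not> weil_bound_at q) \<longrightarrow> \<not> weil_bound_at p)"
    using two_is_prime_nat by blast
  from someI_ex[OF this, folded test_prime_def]
  show "prime test_prime" "prime q \<Longrightarrow> \<not> weil_bound_at q \<Longrightarrow> \<not> weil_bound_at test_prime" by blast+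
qed

typedef test_index = "{..<test_prime}"
  using test_prime(1) prime_gt_0_nat by blast

instance test_index :: prime_card
proof
  show "prime CARD(test_index)"
    unfolding type_definition.card[OF type_definition_test_index] using test_prime by simp
qed

theorem weil_bound_at_prime: "prime p \<Longrightarrow> weil_bound_at p"
proof -
  have "CHAR(test_index mod_ring alg_closure) = test_prime"
    by (simp add: type_definition.card[OF type_definition_test_index])
  hence "weil_bound_at test_prime"
    using weil_bound_at_CHAR[where ?'a = "test_index mod_ring alg_closure"] by simp
  thus "prime p \<Longrightarrow> weil_bound_at p" using test_prime(2) by blast
qed

lemma poly_cong_coeffs:
  fixes G H :: "int poly"
  assumes "\<And>i. [coeff G i = coeff H i] (mod m)"
  shows "[poly G x = poly H x] (mod m)"
proof -
  define n where "n = max (degree G) (degree H)"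
  have P: "poly Q x = (\<Sum>i\<le>n. coeff Q i * x ^ i)" if "degree Q \<le> n" for Q :: "int poly"
    unfolding poly_altdef using that by (intro sum.mono_neutral_left) (auto simp: coeff_eq_0)
  have "poly G x = (\<Sum>i\<le>n. coeff G i * x ^ i)" "poly H x = (\<Sum>i\<le>n. coeff H i * x ^ i)"
    by (rule P, simp add: n_def)+
  thus ?thesis using assms by (auto intro!: cong_sum cong_scalar_right)
qed

text \<open>
A form of the bound that refers to no leading coefficient. After reducing the coefficients modulo
\<open>p\<close>, the degree lies between \<open>i\<close> and \<open>d < p\<close>, so \<open>p\<close> does not divide it.
\<close>

lemma exp_sum_bound:
  fixes G :: "int poly"
  assumes p: "prime p" and deg: "degree G \<le> d" "d < p" and i: "i > 0" "\<not> int p dvd coeff G i"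
  shows "cmod (\<Sum>y\<in>{0..int p - 1}. \<psi> p (poly G y)) \<le> d * sqrt p"
proof -
  have p0: "p > 0" using p prime_gt_0_nat by blast
  define H where "H = map_poly (\<lambda>c. c mod int p) G"
  have cH: "coeff H i = coeff G i mod int p" for i by (simp add: H_def coeff_map_poly)
  have nz: "coeff H i \<noteq> 0" using i by (simp add: cH dvd_eq_mod_eq_0)
  hence dH: "degree H \<ge> i" by (rule le_degree)
  have dHd: "degree H \<le> d" using deg degree_map_poly_le[of "\<lambda>c. c mod int p" G] by (simp add: H_def)
  have "lead_coeff H \<noteq> 0" using nz by auto
  hence 1: "\<not> int p dvd lead_coeff H" unfolding cH by (simp add: dvd_eq_mod_eq_0)
  have 2: "\<not> p dvd degree H" using dH dHd deg i by (auto dest!: dvd_imp_le)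
  have "(\<Sum>y\<in>{0..int p - 1}. \<psi> p (poly G y)) = (\<Sum>k<p. \<psi> p (poly G (int k)))"
    by (rule sum.reindex_bij_witness[of _ int nat]) auto
  also have "\<dots> = (\<Sum>k<p. \<psi> p (poly H (int k)))"
    by (intro sum.cong refl \<psi>_cong[OF p0] poly_cong_coeffs) (simp add: cH cong_def)
  also have "cmod \<dots> \<le> (degree H - 1) * sqrt p"
    using weil_bound_at_prime[OF p] 1 2 unfolding weil_bound_at_def by blast
  also have "\<dots> \<le> d * sqrt p" using dHd by (intro mult_right_mono) auto
  finally show ?thesis .
qed

section \<open>Sums over a level set\<close>

lemma sum_product4:
  fixes a b c d :: "'b \<Rightarrow> 'a::comm_semiring_1"
  shows "(\<Sum>(y1,y2,y3,y4)\<in>F \<times> F \<times> F \<times> F. a y1 * b y2 * c y3 * d y4)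
    = (\<Sum>y\<in>F. a y) * (\<Sum>y\<in>F. b y) * (\<Sum>y\<in>F. c y) * (\<Sum>y\<in>F. d y)"
  by (simp add: sum.cartesian_product[symmetric] mult.assoc flip: sum_distrib_left sum_distrib_right)

text \<open>
Here \<open>z w = 0\<close> modulo \<open>p\<close> is the equation of \<open>W\<close>, and \<open>r w\<close> is the argument of the character. The
hypothesis \<open>indep\<close> ignores the constant coefficients, since it has to exclude constant polynomials.
\<close>

lemma level_set_sum_bound:
  fixes g1 g2 :: "int poly" and p d :: nat and \<alpha> l m m' :: int
  assumes p: "prime p" and d: "degree g1 \<le> d" "degree g2 \<le> d" "d < p"
    and indep: "\<And>u v. (\<And>i. i > 0 \<Longrightarrow> int p dvd u * coeff g1 i + v * coeff g2 i) \<Longrightarrow> int p dvd u \<and> int p dvd v"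
    and l: "\<not> int p dvd l" and \<alpha>: "\<not> int p dvd \<alpha>"
  defines "F \<equiv> {0..int p - 1}"
  defines "z \<equiv> \<lambda>(y1,y2,y3,y4). poly g1 y1 - poly g1 y2 - poly g1 y3 + poly g1 y4"
  defines "r \<equiv> \<lambda>(y1,y2,y3,y4).
      l * ((poly g2 y4 - \<alpha> * poly g1 y4) - (poly g2 y2 - \<alpha> * poly g1 y2))
        + m * (poly g2 y1 - poly g2 y2) + m' * (poly g2 y4 - poly g2 y3)"
  shows "cmod (\<Sum>w\<in>{w \<in> F \<times> F \<times> F \<times> F. int p dvd z w}. \<psi> p (r w)) \<le> (real d ^ 4 + 2 * real d ^ 2) * real p ^ 2"
proof -
  have p0: "p > 0" using p prime_gt_0_nat by blast
  have finF: "finite F" and cardF: "card F = p" by (auto simp: F_def)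
  define T where "T = (\<lambda>u v. \<Sum>y\<in>F. \<psi> p (u * poly g1 y + v * poly g2 y))"
  define B where "B = real d * sqrt p"
  have B0: "B \<ge> 0" by (simp add: B_def)
  have T_triv: "cmod (T u v) \<le> p" for u v
    unfolding T_def by (rule order_trans[OF norm_sum]) (simp add: cardF)
  have T_weil: "cmod (T u v) \<le> B" if "\<not> (int p dvd u \<and> int p dvd v)" for u v
  proof -
    let ?G = "smult u g1 + smult v g2"
    have "\<exists>i>0. \<not> int p dvd u * coeff g1 i + v * coeff g2 i" using indep[of u v] that by blast
    then obtain i where i: "i > 0" "\<not> int p dvd coeff ?G i" by auto
    have "degree ?G \<le> d"
      using d degree_smult_le[of u g1] degree_smult_le[of v g2] by (intro degree_add_le) linarith+
    from exp_sum_bound[OF p this d(3) i] show ?thesis by (simp add: T_def F_def B_def)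
  qed
  (* The factors are the sums over y1, y2, y3 and y4; s is the frequency dual to the equation of W. *)
  define A where "A = (\<lambda>s. T s m * T (l * \<alpha> - s) (- l - m) * T (- s) (- m') * T (s - l * \<alpha>) (l + m'))"
  (* The only frequencies at which a factor of A may miss the Weil bound. *)
  define Y where "Y = {0, (l * \<alpha>) mod int p}"
  have "of_nat p * (\<Sum>w\<in>{w \<in> F \<times> F \<times> F \<times> F. int p dvd z w}. \<psi> p (r w))
      = (\<Sum>w\<in>F \<times> F \<times> F \<times> F. (if int p dvd z w then of_nat p else 0) * \<psi> p (r w))"
    unfolding sum_distrib_left by (rule sum.mono_neutral_cong_left) (auto simp: finF)
  also have "\<dots> = (\<Sum>w\<in>F \<times> F \<times> F \<times> F. \<Sum>s\<in>F. \<psi> p (s * z w + r w))"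
    unfolding sum_\<psi>[OF p0, symmetric] F_def[symmetric] \<psi>_add sum_distrib_right ..
  also have "\<dots> = (\<Sum>s\<in>F. \<Sum>w\<in>F \<times> F \<times> F \<times> F. \<psi> p (s * z w + r w))" by (rule sum.swap)
  also have "\<dots> = (\<Sum>s\<in>F. A s)"
  proof (rule sum.cong[OF refl])
    fix s
    have "(\<Sum>w\<in>F \<times> F \<times> F \<times> F. \<psi> p (s * z w + r w)) = (\<Sum>(y1,y2,y3,y4)\<in>F \<times> F \<times> F \<times> F.
       \<psi> p (s * poly g1 y1 + m * poly g2 y1) * \<psi> p ((l * \<alpha> - s) * poly g1 y2 + (- l - m) * poly g2 y2)
       * \<psi> p ((- s) * poly g1 y3 + (- m') * poly g2 y3) * \<psi> p ((s - l * \<alpha>) * poly g1 y4 + (l + m') * poly g2 y4))"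
      by (rule sum.cong) (auto simp: z_def r_def algebra_simps simp flip: \<psi>_add)
    also have "\<dots> = A s" unfolding A_def T_def by (rule sum_product4)
    finally show "(\<Sum>w\<in>F \<times> F \<times> F \<times> F. \<psi> p (s * z w + r w)) = A s" .
  qed
  finally have eq: "of_nat p * (\<Sum>w\<in>{w \<in> F \<times> F \<times> F \<times> F. int p dvd z w}. \<psi> p (r w)) = (\<Sum>s\<in>F. A s)" .
  have l\<alpha>: "\<not> int p dvd l * \<alpha>" using p l \<alpha> by (simp add: prime_dvd_mult_iff)
  have prod4: "cmod (a * b * c * e) \<le> x1 * x2 * x3 * x4"
    if "cmod a \<le> x1" "cmod b \<le> x2" "cmod c \<le> x3" "cmod e \<le> x4" for a b c e and x1 x2 x3 x4 :: real
    unfolding norm_mult using that by (intro mult_mono) (auto intro: order_trans[OF norm_ge_zero] mult_nonneg_nonneg)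
  have A_bound: "cmod (A s) \<le> B ^ 4 + (if s \<in> Y then B ^ 2 * real p ^ 2 else 0)" if s: "s \<in> F" for s
  proof (cases "s \<in> Y")
    case True
    have "cmod (A s) \<le> B ^ 2 * real p ^ 2"
    proof (cases "s = 0")
      case True
      have "cmod (A s) \<le> p * B * p * B"
        unfolding A_def using True l\<alpha> by (intro prod4 T_triv T_weil) auto
      thus ?thesis by (simp add: power2_eq_square mult_ac)
    next
      case False
      hence s0: "\<not> int p dvd s" using s zdvd_not_zless[of s "int p"] by (auto simp: F_def)
      hence "cmod (A s) \<le> B * p * B * p"
        unfolding A_def by (intro prod4 T_triv T_weil) auto
      thus ?thesis by (simp add: power2_eq_square mult_ac)
    qed
    moreover have "B ^ 4 \<ge> 0" using B0 by (rule zero_le_power)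
    ultimately show ?thesis unfolding if_P[OF True] by linarith
  next
    case False
    have s0: "\<not> int p dvd s" using False s zdvd_not_zless[of s "int p"] by (auto simp: F_def Y_def)
    have s1: "\<not> int p dvd s - l * \<alpha>"
    proof
      assume "int p dvd s - l * \<alpha>"
      hence "s mod int p = (l * \<alpha>) mod int p" by (simp add: mod_eq_dvd_iff)
      thus False using False s by (simp add: F_def Y_def)
    qed
    hence s2: "\<not> int p dvd l * \<alpha> - s" by (metis dvd_diff_commute)
    have "cmod (A s) \<le> B * B * B * B"
      unfolding A_def using s0 s1 s2 by (intro prod4 T_weil) auto
    thus ?thesis using False by (simp add: power4_eq_xxxx)
  qed
  have B2: "B ^ 2 = real d ^ 2 * p" by (simp add: B_def power_mult_distrib)
  have B4: "B ^ 4 = real d ^ 4 * p ^ 2" by (simp add: B_def power_mult_distrib power4_eq_xxxx power2_eq_square)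
  have "real p * cmod (\<Sum>w\<in>{w \<in> F \<times> F \<times> F \<times> F. int p dvd z w}. \<psi> p (r w)) = cmod (\<Sum>s\<in>F. A s)"
    unfolding eq[symmetric] by (simp add: norm_mult)
  also have "\<dots> \<le> (\<Sum>s\<in>F. B ^ 4 + (if s \<in> Y then B ^ 2 * real p ^ 2 else 0))"
    by (rule sum_norm_le) (rule A_bound)
  also have "\<dots> = p * B ^ 4 + card (F \<inter> Y) * (B ^ 2 * real p ^ 2)"
    using finF by (simp add: sum.distrib cardF sum.If_cases)
  also have "card (F \<inter> Y) \<le> card Y" by (intro card_mono) (auto simp: Y_def)
  hence "card (F \<inter> Y) * (B ^ 2 * real p ^ 2) \<le> 2 * (B ^ 2 * real p ^ 2)"
    by (intro mult_right_mono) (auto simp: Y_def card_insert_if split: if_splits)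
  also have "p * B ^ 4 + 2 * (B ^ 2 * real p ^ 2) = real p * ((real d ^ 4 + 2 * real d ^ 2) * real p ^ 2)"
    by (simp add: B2 B4 algebra_simps)
  finally show ?thesis using p0 by simp
qed

section \<open>Coefficient lists over a prime field\<close>

text \<open>
Coefficient lists start with the leading coefficient.
\<close>

definition int_poly :: "int list \<Rightarrow> int poly" where
  "int_poly \<phi> = Poly (rev \<phi>)"

lemma int_poly_Cons: "int_poly (a # \<phi>) = int_poly \<phi> + monom a (length \<phi>)"
  by (simp add: int_poly_def Poly_append Poly_snoc mult_monom smult_monom flip: monom_0)

lemma coeff_int_poly: "coeff (int_poly \<phi>) i = (if i < length \<phi> then \<phi> ! (length \<phi> - Suc i) else 0)"
  by (auto simp: int_poly_def nth_default_def rev_nth)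

lemma degree_int_poly: "degree (int_poly \<phi>) \<le> length \<phi> - 1"
  by (rule degree_le) (auto simp: coeff_int_poly)

lemma eval_int_poly:
  assumes p: "prime p" and "set \<phi> \<subseteq> carrier (\<bbbF> p)" and x: "x \<in> carrier (\<bbbF> p)"
  shows "ring.eval (\<bbbF> p) \<phi> x = poly (int_poly \<phi>) x mod int p"
proof -
  interpret R: residues_prime p "\<bbbF> p" by unfold_locales fact
  have xm: "x mod int p = x" using x by (simp add: R.res_carrier_eq)
  have pow: "x [^]\<^bsub>\<bbbF> p\<^esub> n = x ^ n mod int p" for n :: nat using R.pow_cong[of x n] by (simp add: xm)
  show ?thesis
    using assms(2)
  proof (induction \<phi>)
    case Nil
    show ?case by (simp add: int_poly_def R.res_zero_eq)
  next
    case (Cons a \<phi>)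
    thus ?case
      by (simp add: R.res_add_eq R.res_mult_eq pow int_poly_Cons poly_monom mod_simps add.commute)
         (metis mod_add_right_eq mod_mult_right_eq)
  qed
qed

lemma poly_ring_carrier_prime_field:
  assumes "\<phi> \<in> carrier (poly_ring (\<bbbF> p))"
  shows "set \<phi> \<subseteq> carrier (\<bbbF> p)" and "\<phi> \<noteq> [] \<Longrightarrow> hd \<phi> \<noteq> 0"
  using assms by (auto simp: univ_poly_def polynomial_def residue_ring_def)

text \<open>
If \<open>u\<close> were invertible modulo \<open>p\<close>, then \<open>\<phi>1\<close> would be \<open>- v / u\<close> times \<open>\<phi>2\<close> and lie in its span. So
\<open>p\<close> divides \<open>u\<close>, and then \<open>v\<close> because the leading coefficient of \<open>\<phi>2\<close> is nonzero.
\<close>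

lemma lin_indep_int_poly:
  assumes p: "prime p"
    and \<phi>: "\<phi>1 \<in> carrier (poly_ring (\<bbbF> p))" "\<phi>2 \<in> carrier (poly_ring (\<bbbF> p))"
    and len: "length \<phi>1 = Suc d" "length \<phi>2 = Suc d"
    and ind: "lin_indep (\<bbbF> p) \<phi>1 \<phi>2"
    and uv: "\<And>i. int p dvd u * coeff (int_poly \<phi>1) i + v * coeff (int_poly \<phi>2) i"
  shows "int p dvd u \<and> int p dvd v"
proof -
  interpret R: residues_prime p "\<bbbF> p" by unfold_locales fact
  interpret UP: ring "poly_ring (\<bbbF> p)" by (rule R.univ_poly_is_ring[OF R.carrier_is_subring])
  have pi: "prime (int p)" using p by simp
  have carr: "set \<phi>1 \<subseteq> {0..int p - 1}" "set \<phi>2 \<subseteq> {0..int p - 1}"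
    using poly_ring_carrier_prime_field(1)[OF \<phi>(1)] poly_ring_carrier_prime_field(1)[OF \<phi>(2)]
    by (auto simp: R.res_carrier_eq)
  have top: "\<not> int p dvd coeff (int_poly \<phi>) d"
    if "\<phi> \<in> carrier (poly_ring (\<bbbF> p))" "length \<phi> = Suc d" "set \<phi> \<subseteq> {0..int p - 1}" for \<phi>
  proof -
    have "\<phi> \<noteq> []" using that by auto
    hence "hd \<phi> \<noteq> 0" "hd \<phi> \<in> set \<phi>"
      using poly_ring_carrier_prime_field(2)[OF that(1)] by (blast, simp)
    hence "hd \<phi> \<noteq> 0" "hd \<phi> \<in> {0..int p - 1}" using that(3) by blast+
    moreover have "coeff (int_poly \<phi>) d = hd \<phi>" using that \<open>\<phi> \<noteq> []\<close> by (simp add: coeff_int_poly hd_conv_nth)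
    ultimately show ?thesis using zdvd_not_zless[of "hd \<phi>" "int p"] by auto
  qed
  have u: "int p dvd u"
  proof (rule ccontr)
    assume "\<not> int p dvd u"
    from prime_imp_coprime[OF pi this] have "coprime u (int p)" by (simp add: coprime_commute)
    then obtain u' where u': "[u * u' = 1] (mod int p)" using cong_solve_coprime_int by blast
    (* c is nonzero by the leading coefficient of the first polynomial, so that multiplying by the
       constant polynomial c acts entrywise on coefficient lists, without normalisation. *)
    define c where "c = (- v * u') mod int p"
    have cong: "[coeff (int_poly \<phi>1) i = c * coeff (int_poly \<phi>2) i] (mod int p)" for i
    proof -
      let ?a = "coeff (int_poly \<phi>1) i" and ?b = "coeff (int_poly \<phi>2) i"
      have "[u' * (u * ?a + v * ?b) = 0] (mod int p)" using uv[of i] by (simp add: cong_0_iff)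
      hence "[(u * u') * ?a + u' * v * ?b = 0] (mod int p)" by (simp add: algebra_simps)
      moreover have "[(u * u') * ?a + u' * v * ?b = 1 * ?a + u' * v * ?b] (mod int p)"
        by (intro cong_add cong_mult u' cong_refl)
      ultimately have "[?a + u' * v * ?b = 0] (mod int p)" by (metis cong_sym cong_trans mult_1)
      hence "[?a = - (v * u') * ?b] (mod int p)" by (simp add: cong_iff_dvd_diff algebra_simps)
      also have "[- (v * u') * ?b = c * ?b] (mod int p)"
        unfolding c_def by (intro cong_mult cong_refl) (simp add: cong_def)
      finally show ?thesis .
    qed
    have c: "c \<in> carrier (\<bbbF> p)" "c \<noteq> 0"
    proof -
      show "c \<in> carrier (\<bbbF> p)" unfolding c_def by simp
      show "c \<noteq> 0"
      proof
        assume "c = 0"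
        thus False using cong[of d] top[OF \<phi>(1) len(1) carr(1)] by (simp add: cong_0_iff)
      qed
    qed
    have "\<phi>1 = map (\<lambda>b. c \<otimes>\<^bsub>\<bbbF> p\<^esub> b) \<phi>2"
    proof (rule nth_equalityI)
      fix j assume j: "j < length \<phi>1"
      hence jd: "j \<le> d" by (simp add: len)
      have "\<phi>1 ! j mod int p = c * \<phi>2 ! j mod int p"
        using cong[of "d - j"] jd by (simp add: coeff_int_poly len cong_def le_imp_less_Suc)
      moreover have "\<phi>1 ! j \<in> {0..int p - 1}" using carr(1) nth_mem[OF j] by blast
      ultimately show "\<phi>1 ! j = map (\<lambda>b. c \<otimes>\<^bsub>\<bbbF> p\<^esub> b) \<phi>2 ! j" using j len by (simp add: R.res_mult_eq)
    qed (simp add: len)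
    also have "\<dots> = ring.poly_of_const (\<bbbF> p) c \<otimes>\<^bsub>poly_ring (\<bbbF> p)\<^esub> \<phi>2"
      using R.poly_mult_const(1)[OF R.carrier_is_subring, of \<phi>2 c] \<phi>(2) c
      by (simp add: univ_poly_carrier univ_poly_mult R.poly_of_const_def R.res_zero_eq)
    finally have eq: "\<phi>1 = ring.poly_of_const (\<bbbF> p) c \<otimes>\<^bsub>poly_ring (\<bbbF> p)\<^esub> \<phi>2" .
    hence "\<phi>1 = ring.poly_of_const (\<bbbF> p) c \<otimes>\<^bsub>poly_ring (\<bbbF> p)\<^esub> \<phi>2 \<oplus>\<^bsub>poly_ring (\<bbbF> p)\<^esub> \<zero>\<^bsub>poly_ring (\<bbbF> p)\<^esub>"
      using UP.r_zero[OF \<phi>(1)] by simp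
    hence "\<phi>1 \<in> UP.line_extension (ring.poly_of_const (\<bbbF> p) ` carrier (\<bbbF> p)) \<phi>2 {\<zero>\<^bsub>poly_ring (\<bbbF> p)\<^esub>}"
      unfolding UP.line_extension_mem_iff using c(1) by blast
    hence "\<phi>1 \<in> UP.Span (ring.poly_of_const (\<bbbF> p) ` carrier (\<bbbF> p)) [\<phi>2]" by simp
    thus False using UP.independent_backwards(1)[OF ind[unfolded lin_indep_def]] by blast
  qed
  moreover have "int p dvd v"
  proof -
    have "int p dvd v * coeff (int_poly \<phi>2) d" using uv[of d] u by (simp add: dvd_add_right_iff)
    thus ?thesis using top[OF \<phi>(2) len(2) carr(2)] pi by (simp add: prime_dvd_mult_iff)
  qed
  ultimately show ?thesis by blast
qed

lemma lc_ratio_nonzero: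
  assumes p: "prime p"
    and \<phi>: "\<phi>1 \<in> carrier (poly_ring (\<bbbF> p))" "\<phi>2 \<in> carrier (poly_ring (\<bbbF> p))" "\<phi>1 \<noteq> []" "\<phi>2 \<noteq> []"
  shows "lc_ratio (\<bbbF> p) \<phi>1 \<phi>2 \<in> carrier (\<bbbF> p) - {0}"
proof -
  interpret R: residues_prime p "\<bbbF> p" by unfold_locales fact
  have "hd \<phi>1 \<in> carrier (\<bbbF> p) - {0}" "hd \<phi>2 \<in> carrier (\<bbbF> p) - {0}"
    using poly_ring_carrier_prime_field[OF \<phi>(1)] poly_ring_carrier_prime_field[OF \<phi>(2)] \<phi>(3,4) hd_in_set by blast+
  thus ?thesis
    using R.field_Units R.integral_iff[of "hd \<phi>2" "inv\<^bsub>\<bbbF> p\<^esub> hd \<phi>1"]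
      R.Units_inv_Units[of "hd \<phi>1"]
    by (auto simp: lc_ratio_def R.res_zero_eq)
qed

lemma eval_D_poly:
  assumes p: "prime p"
    and \<phi>: "\<phi>1 \<in> carrier (poly_ring (\<bbbF> p))" "\<phi>2 \<in> carrier (poly_ring (\<bbbF> p))" "\<phi>1 \<noteq> []" "\<phi>2 \<noteq> []"
    and x: "x \<in> carrier (\<bbbF> p)"
  shows "ring.eval (\<bbbF> p) (D_poly (\<bbbF> p) \<phi>1 \<phi>2) x
    = (poly (int_poly \<phi>2) x - lc_ratio (\<bbbF> p) \<phi>1 \<phi>2 * poly (int_poly \<phi>1) x) mod int p"
proof -
  interpret R: residues_prime p "\<bbbF> p" by unfold_locales fact
  interpret UP: ring "poly_ring (\<bbbF> p)" by (rule R.univ_poly_is_ring[OF R.carrier_is_subring])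
  interpret H: ring_hom_ring "poly_ring (\<bbbF> p)" "\<bbbF> p" "\<lambda>q. ring.eval (\<bbbF> p) q x"
    by (rule R.eval_ring_hom[OF R.carrier_is_subring x])
  define \<alpha> where "\<alpha> = lc_ratio (\<bbbF> p) \<phi>1 \<phi>2"
  have \<alpha>: "\<alpha> \<in> carrier (\<bbbF> p)" "\<alpha> \<noteq> 0" using lc_ratio_nonzero[OF p \<phi>] by (auto simp: \<alpha>_def)
  have const: "ring.poly_of_const (\<bbbF> p) \<alpha> = [\<alpha>]" using \<alpha> by (simp add: R.poly_of_const_def R.res_zero_eq)
  have cc: "[\<alpha>] \<in> carrier (poly_ring (\<bbbF> p))" using \<alpha> by (simp add: univ_poly_def polynomial_def R.res_zero_eq)
  have ev: "ring.eval (\<bbbF> p) [\<alpha>] x = \<alpha>" using \<alpha> x by simp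
  have e: "ring.eval (\<bbbF> p) \<phi>1 x = poly (int_poly \<phi>1) x mod int p" "ring.eval (\<bbbF> p) \<phi>2 x = poly (int_poly \<phi>2) x mod int p"
    using eval_int_poly[OF p _ x] poly_ring_carrier_prime_field(1) \<phi>(1,2) by blast+
  have "ring.eval (\<bbbF> p) (D_poly (\<bbbF> p) \<phi>1 \<phi>2) x
    = ring.eval (\<bbbF> p) \<phi>2 x \<ominus>\<^bsub>\<bbbF> p\<^esub> \<alpha> \<otimes>\<^bsub>\<bbbF> p\<^esub> ring.eval (\<bbbF> p) \<phi>1 x"
    unfolding D_poly_def \<alpha>_def[symmetric] const using \<phi> cc by (simp add: a_minus_def ev del: R.eval.simps)
  also have "\<dots> = (poly (int_poly \<phi>2) x - \<alpha> * poly (int_poly \<phi>1) x) mod int p"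
    unfolding e by (simp add: a_minus_def R.res_add_eq R.res_mult_eq R.res_neg_eq mod_simps)
  finally show ?thesis by (simp add: \<alpha>_def)
qed

section \<open>The estimate\<close>

theorem theorem6p6:
  fixes d :: nat
  assumes "d \<ge> 3"
  shows "\<exists>C::real. \<forall>(p::nat) \<phi>1 \<phi>2 l m m'.
    prime p \<longrightarrow>
    \<phi>1 \<in> carrier (poly_ring (\<bbbF> p)) \<longrightarrow>
    \<phi>2 \<in> carrier (poly_ring (\<bbbF> p)) \<longrightarrow>
    ring.eval (\<bbbF> p) \<phi>1 \<zero>\<^bsub>\<bbbF> p\<^esub> = \<zero>\<^bsub>\<bbbF> p\<^esub> \<longrightarrow>
    ring.eval (\<bbbF> p) \<phi>2 \<zero>\<^bsub>\<bbbF> p\<^esub> = \<zero>\<^bsub>\<bbbF> p\<^esub> \<longrightarrow>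
    lin_indep (\<bbbF> p) \<phi>1 \<phi>2 \<longrightarrow>
    Polynomials.degree \<phi>1 = d \<longrightarrow>
    Polynomials.degree \<phi>2 = d \<longrightarrow>
    l \<in> carrier (\<bbbF> p) - {\<zero>\<^bsub>\<bbbF> p\<^esub>} \<longrightarrow>
    m \<in> carrier (\<bbbF> p) \<longrightarrow>
    m' \<in> carrier (\<bbbF> p) \<longrightarrow>
    cmod (S_sum p \<phi>1 \<phi>2 l m m') \<le> C * real p ^ 2"
proof (intro exI[of _ "real d ^ 4 + 2 * real d ^ 2"] allI impI)
  fix p :: nat and \<phi>1 \<phi>2 :: "int list" and l m m' :: int
  assume p: "prime p"
    and \<phi>: "\<phi>1 \<in> carrier (poly_ring (\<bbbF> p))" "\<phi>2 \<in> carrier (poly_ring (\<bbbF> p))"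
    and ev0: "ring.eval (\<bbbF> p) \<phi>1 \<zero>\<^bsub>\<bbbF> p\<^esub> = \<zero>\<^bsub>\<bbbF> p\<^esub>" "ring.eval (\<bbbF> p) \<phi>2 \<zero>\<^bsub>\<bbbF> p\<^esub> = \<zero>\<^bsub>\<bbbF> p\<^esub>"
    and ind: "lin_indep (\<bbbF> p) \<phi>1 \<phi>2"
    and deg: "Polynomials.degree \<phi>1 = d" "Polynomials.degree \<phi>2 = d"
    and l: "l \<in> carrier (\<bbbF> p) - {\<zero>\<^bsub>\<bbbF> p\<^esub>}" and m: "m \<in> carrier (\<bbbF> p)" "m' \<in> carrier (\<bbbF> p)"
  interpret R: residues_prime p "\<bbbF> p" by unfold_locales fact
  have p0: "p > 0" using p prime_gt_0_nat by blast
  define F where "F = {0..int p - 1}"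
  have carF: "carrier (\<bbbF> p) = F" by (simp add: R.res_carrier_eq F_def)
  have len: "length \<phi>1 = Suc d" "length \<phi>2 = Suc d" using deg assms by linarith+
  have ne: "\<phi>1 \<noteq> []" "\<phi>2 \<noteq> []" using len by auto
  show "cmod (S_sum p \<phi>1 \<phi>2 l m m') \<le> (real d ^ 4 + 2 * real d ^ 2) * real p ^ 2"
  proof (cases "d < p")
    case False
    have "cmod (S_sum p \<phi>1 \<phi>2 l m m') \<le> card (W_points (\<bbbF> p) \<phi>1)"
      unfolding S_sum_def by (rule order_trans[OF norm_sum]) simp
    also have "card (W_points (\<bbbF> p) \<phi>1) \<le> card (F \<times> F \<times> F \<times> F)"
      by (intro card_mono) (auto simp: W_points_def carF F_def)
    also have "real (card (F \<times> F \<times> F \<times> F)) = real p ^ 2 * real p ^ 2"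
      by (simp add: card_cartesian_product F_def power2_eq_square)
    also have "\<dots> \<le> real d ^ 2 * real p ^ 2"
      using False by (intro mult_right_mono power_mono) auto
    also have "\<dots> \<le> (real d ^ 4 + 2 * real d ^ 2) * real p ^ 2"
      by (intro mult_right_mono) auto
    finally show ?thesis by simp
  next
    case True
    define g1 g2 \<alpha> where "g1 = int_poly \<phi>1" and "g2 = int_poly \<phi>2" and "\<alpha> = lc_ratio (\<bbbF> p) \<phi>1 \<phi>2"
    have e1: "ring.eval (\<bbbF> p) \<phi>1 y = poly g1 y mod int p" and e2: "ring.eval (\<bbbF> p) \<phi>2 y = poly g2 y mod int p"
      and eD: "ring.eval (\<bbbF> p) (D_poly (\<bbbF> p) \<phi>1 \<phi>2) y = (poly g2 y - \<alpha> * poly g1 y) mod int p"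
      if "y \<in> F" for y
      using eval_int_poly[OF p poly_ring_carrier_prime_field(1)] eval_D_poly[OF p \<phi> ne] that \<phi>
      unfolding g1_def g2_def \<alpha>_def carF by blast+
    have zeroF: "0 \<in> F" using p0 by (simp add: F_def)
    have const0: "int p dvd coeff g1 0" "int p dvd coeff g2 0"
      using ev0 e1[OF zeroF] e2[OF zeroF] by (auto simp: R.res_zero_eq poly_0_coeff_0 dvd_eq_mod_eq_0)
    have ndvd: "\<not> int p dvd k" if "k \<in> F - {0}" for k
      using that zdvd_not_zless[of k "int p"] by (auto simp: F_def)
    define z where "z = (\<lambda>(y1,y2,y3,y4). poly g1 y1 - poly g1 y2 - poly g1 y3 + poly g1 y4)"
    define r where "r = (\<lambda>(y1,y2,y3,y4).
      l * ((poly g2 y4 - \<alpha> * poly g1 y4) - (poly g2 y2 - \<alpha> * poly g1 y2))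
        + m * (poly g2 y1 - poly g2 y2) + m' * (poly g2 y4 - poly g2 y3))"
    have W: "W_points (\<bbbF> p) \<phi>1 = {w \<in> F \<times> F \<times> F \<times> F. int p dvd z w}"
    proof -
      have "ring.eval (\<bbbF> p) \<phi>1 y1 \<ominus>\<^bsub>\<bbbF> p\<^esub> ring.eval (\<bbbF> p) \<phi>1 y2
          = ring.eval (\<bbbF> p) \<phi>1 y3 \<ominus>\<^bsub>\<bbbF> p\<^esub> ring.eval (\<bbbF> p) \<phi>1 y4 \<longleftrightarrow> int p dvd z (y1,y2,y3,y4)"
        if "y1 \<in> F" "y2 \<in> F" "y3 \<in> F" "y4 \<in> F" for y1 y2 y3 y4
        using that
        by (simp add: e1 a_minus_def R.res_add_eq R.res_neg_eq mod_simps z_def mod_eq_dvd_iff algebra_simps)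
      thus ?thesis unfolding W_points_def carF by auto
    qed
    have summand: "\<psi> p (f0 (\<bbbF> p) \<phi>1 \<phi>2 l w \<oplus>\<^bsub>\<bbbF> p\<^esub> m \<otimes>\<^bsub>\<bbbF> p\<^esub> f1 (\<bbbF> p) \<phi>2 w
             \<oplus>\<^bsub>\<bbbF> p\<^esub> m' \<otimes>\<^bsub>\<bbbF> p\<^esub> f2 (\<bbbF> p) \<phi>2 w) = \<psi> p (r w)" if "w \<in> F \<times> F \<times> F \<times> F" for w
    proof -
      obtain y1 y2 y3 y4 where w: "w = (y1,y2,y3,y4)" by (cases w)
      have y: "y1 \<in> F" "y2 \<in> F" "y3 \<in> F" "y4 \<in> F" using that by (auto simp: w)
      have 0: "[f0 (\<bbbF> p) \<phi>1 \<phi>2 l w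
          = l * ((poly g2 y4 - \<alpha> * poly g1 y4) - (poly g2 y2 - \<alpha> * poly g1 y2))] (mod int p)"
        using y by (simp add: w f0_def eD a_minus_def R.res_add_eq R.res_mult_eq R.res_neg_eq cong_def mod_simps)
          (metis mod_diff_eq mod_mult_right_eq)
      have 1: "[f1 (\<bbbF> p) \<phi>2 w = poly g2 y1 - poly g2 y2] (mod int p)"
        and 2: "[f2 (\<bbbF> p) \<phi>2 w = poly g2 y4 - poly g2 y3] (mod int p)"
        using y by (simp_all add: w f1_def f2_def e2 a_minus_def R.res_add_eq R.res_neg_eq cong_def mod_simps)
      have "[f0 (\<bbbF> p) \<phi>1 \<phi>2 l w + m * f1 (\<bbbF> p) \<phi>2 w + m' * f2 (\<bbbF> p) \<phi>2 w = r w] (mod int p)"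
        unfolding r_def w prod.case using 0 1 2 unfolding w by (intro cong_add cong_mult cong_refl)
      from \<psi>_cong[OF p0 this] show ?thesis using p0 by (simp add: R.res_add_eq R.res_mult_eq mod_simps)
    qed
    have "S_sum p \<phi>1 \<phi>2 l m m' = (\<Sum>w\<in>{w \<in> F \<times> F \<times> F \<times> F. int p dvd z w}. \<psi> p (r w))"
      unfolding S_sum_def W by (rule sum.cong) (auto intro!: summand)
    also have "cmod \<dots> \<le> (real d ^ 4 + 2 * real d ^ 2) * real p ^ 2"
      unfolding F_def z_def r_def
    proof (rule level_set_sum_bound[OF p])
      show "degree g1 \<le> d" "degree g2 \<le> d"
        using degree_int_poly[of \<phi>1] degree_int_poly[of \<phi>2] by (simp_all add: len g1_def g2_def)
      show "\<not> int p dvd l" using l by (intro ndvd) (auto simp: carF R.res_zero_eq)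
      show "\<not> int p dvd \<alpha>" using lc_ratio_nonzero[OF p \<phi> ne] by (intro ndvd) (auto simp: carF \<alpha>_def)
      show "int p dvd u \<and> int p dvd v" if "\<And>i. i > 0 \<Longrightarrow> int p dvd u * coeff g1 i + v * coeff g2 i" for u v
      proof (rule lin_indep_int_poly[OF p \<phi> len ind])
        fix i show "int p dvd u * coeff (int_poly \<phi>1) i + v * coeff (int_poly \<phi>2) i"
          using that[of i] const0 by (cases "i = 0") (auto simp: g1_def g2_def)
      qed
    qed fact
    finally show ?thesis .
  qed
qed

end
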